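(* Let $\Omega\subset\mathbb{C}^n$ be a bounded domain. For $0<p<1$ equip $A^p(\Omega)$ with the metric $d(f,g)=\int_\Omega|f-g|^p$, and for $z\in\Omega$ put $$d_p(z)=\sup\{d(f_p,g_p)\},$$ where the supremum is taken over all pairs $f_p,g_p$ of maximizers of $K_p(z)$ satisfying $f_p(z)=g_p(z)=1$. Then for every $z\in\Omega$, $$\lim_{p\to1^-}d_p(z)=0.$$
   Context: For a bounded domain $\Omega\subset\mathbb{C}^n$ and $p>0$, $A^p(\Omega)$ is the space of holomorphic functions $f$ on $\Omega$ with $\|f\|_p=(\int_\Omega |f|^p)^{1/p}<\infty$ (Lebesgue measure). The $p$-Bergman kernel is $$K_p(z)=\sup_{f\in A^p(\Omega)\setminus\{0\}}\frac{|f(z)|^p}{\|f\|_p^p}.$$ A maximizer of $K_p(z)$ is a function $f\in A^p(\Omega)\setminus\{0\}$ with $|f(z)|^p/\|f\|_p^p=K_p(z)$. At least one maximizer with $f(z)=1$ exists for every $p>0$. *)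

theory Defs
  imports "HOL-Analysis.Analysis"
begin

text \<open>
  Functions on \<open>\<Omega> \<subseteq> \<complex>\<^sup>n\<close> are total functions \<open>complex ^ 'n \<Rightarrow> complex\<close> whose values
  outside \<open>\<Omega>\<close> are irrelevant to every notion below.
\<close>

definition bounded_domain :: "(complex ^ 'n) set \<Rightarrow> bool" where
  "bounded_domain \<Omega> \<longleftrightarrow> open \<Omega> \<and> connected \<Omega> \<and> \<Omega> \<noteq> {} \<and> bounded \<Omega>"

text \<open>
  Holomorphy in several variables (on open sets): the real Frechet derivative exists at every
  point and is complex linear.
\<close>

definition holomorphic_vec_on :: "(complex ^ 'n \<Rightarrow> complex) \<Rightarrow> (complex ^ 'n) set \<Rightarrow> bool" where
  "holomorphic_vec_on f \<Omega> \<longleftrightarrow>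
     (\<forall>z\<in>\<Omega>. \<exists>D. (f has_derivative D) (at z) \<and> (\<forall>c v. D (c *s v) = c * D v))"

definition bergman_space :: "(complex ^ 'n) set \<Rightarrow> real \<Rightarrow> (complex ^ 'n \<Rightarrow> complex) set" where
  "bergman_space \<Omega> p =
     {f. holomorphic_vec_on f \<Omega> \<and> set_integrable lebesgue \<Omega> (\<lambda>w. cmod (f w) powr p)}"

definition bergman_norm :: "(complex ^ 'n) set \<Rightarrow> real \<Rightarrow> (complex ^ 'n \<Rightarrow> complex) \<Rightarrow> real" where
  "bergman_norm \<Omega> p f = (LINT w:\<Omega>|lebesgue. cmod (f w) powr p) powr (1 / p)"

definition bergman_nonzero :: "(complex ^ 'n) set \<Rightarrow> real \<Rightarrow> (complex ^ 'n \<Rightarrow> complex) set" where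
  "bergman_nonzero \<Omega> p = {f \<in> bergman_space \<Omega> p. \<exists>w\<in>\<Omega>. f w \<noteq> 0}"

definition bergman_quotient ::
    "(complex ^ 'n) set \<Rightarrow> real \<Rightarrow> complex ^ 'n \<Rightarrow> (complex ^ 'n \<Rightarrow> complex) \<Rightarrow> real" where
  "bergman_quotient \<Omega> p z f = cmod (f z) powr p / bergman_norm \<Omega> p f powr p"

text \<open>
  The suprema are taken in \<^typ>\<open>ennreal\<close>, so that they are genuine suprema without an a priori
  boundedness proof.
\<close>

definition bergman_kernel :: "(complex ^ 'n) set \<Rightarrow> real \<Rightarrow> complex ^ 'n \<Rightarrow> ennreal" where
  "bergman_kernel \<Omega> p z = (SUP f\<in>bergman_nonzero \<Omega> p. ennreal (bergman_quotient \<Omega> p z f))"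

definition maximizer ::
    "(complex ^ 'n) set \<Rightarrow> real \<Rightarrow> complex ^ 'n \<Rightarrow> (complex ^ 'n \<Rightarrow> complex) \<Rightarrow> bool" where
  "maximizer \<Omega> p z f \<longleftrightarrow>
     f \<in> bergman_nonzero \<Omega> p \<and> ennreal (bergman_quotient \<Omega> p z f) = bergman_kernel \<Omega> p z"

definition bergman_dist ::
    "(complex ^ 'n) set \<Rightarrow> real \<Rightarrow> (complex ^ 'n \<Rightarrow> complex) \<Rightarrow> (complex ^ 'n \<Rightarrow> complex) \<Rightarrow> real" where
  "bergman_dist \<Omega> p f g = (LINT w:\<Omega>|lebesgue. cmod (f w - g w) powr p)"

definition maximizer_diam :: "(complex ^ 'n) set \<Rightarrow> real \<Rightarrow> complex ^ 'n \<Rightarrow> ennreal" where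
  "maximizer_diam \<Omega> p z =
     Sup {ennreal (bergman_dist \<Omega> p f g) | f g.
            maximizer \<Omega> p z f \<and> maximizer \<Omega> p z g \<and> f z = 1 \<and> g z = 1}"

end

theory Submission
  imports Defs "HOL-Complex_Analysis.Great_Picard"
begin

text \<open>
  Maximizers with value \<open>1\<close> at \<open>z\<close> are the minimizers of \<open>\<integral>|h|\<^sup>p\<close> among \<open>h(z) = 1\<close>. Along a sequence
  \<open>p\<^sub>j \<longlongrightarrow> 1\<close>, take minimizers \<open>f\<^sub>j\<close>, \<open>g\<^sub>j\<close> with the common minimum \<open>m\<^sub>j\<close>. They are locally bounded
  uniformly in \<open>j\<close>, so after passing to a subsequence \<open>f\<^sub>j \<longlongrightarrow> f\<close> and \<open>g\<^sub>j \<longlongrightarrow> g\<close> pointwise. Since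
  \<open>m\<^sub>j \<le> \<integral>|(f\<^sub>j + g\<^sub>j)/2|\<^sup>p\<close>, Fatou's lemma forces \<open>|f + g| = |f| + |g|\<close>; thus \<open>f/g\<close> is real and
  holomorphic on complex lines through \<open>z\<close>, and \<open>f = g\<close> by the identity theorem. Comparing \<open>f\<^sub>j\<close> with
  the minimizers for smaller exponents shows \<open>limsup m\<^sub>j \<le> \<integral>|f|\<close>, that is, no mass is lost in the limit,
  and Fatou's lemma for \<open>|f\<^sub>j|\<^sup>p + |g\<^sub>j|\<^sup>p - |f\<^sub>j - g\<^sub>j|\<^sup>p \<ge> 0\<close> gives \<open>\<integral>|f\<^sub>j - g\<^sub>j|\<^sup>p \<longlongrightarrow> 0\<close>.
\<close>

section \<open>Sub-mean value property over balls\<close>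

lemma nn_integral_lborel_translate:
  fixes f :: "'a::euclidean_space \<Rightarrow> ennreal"
  assumes [measurable]: "f \<in> borel_measurable borel"
  shows "(\<integral>\<^sup>+x. f (c + x) \<partial>lborel) = (\<integral>\<^sup>+x. f x \<partial>lborel)"
proof -
  have "(\<integral>\<^sup>+x. f x \<partial>lborel) = (\<integral>\<^sup>+x. f x \<partial>distr lborel borel ((+) c))"
    by (simp add: lborel_distr_plus)
  also have "\<dots> = (\<integral>\<^sup>+x. f (c + x) \<partial>lborel)"
    by (subst nn_integral_distr) auto
  finally show ?thesis ..
qed

text \<open>
  Uniqueness of Haar measure in disguise: the two Tonelli evaluations of
  \<open>\<integral>\<integral> 1\<^sub>A(T x + y) 1\<^sub>B(y) dx dy\<close> with \<open>B\<close> the unit ball are \<open>|T\<^sup>-\<^sup>1 A| |B|\<close> and \<open>|A| |B|\<close>.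
\<close>
lemma lborel_distr_orthogonal:
  fixes T :: "'a::euclidean_space \<Rightarrow> 'a"
  assumes T: "orthogonal_transformation T"
  shows "distr lborel borel T = lborel"
proof (rule measure_eqI)
  show "sets (distr lborel borel T) = sets lborel" by simp
next
  fix A assume "A \<in> sets (distr lborel borel T)"
  then have A[measurable]: "A \<in> sets borel" by simp
  have lin: "linear T" using T by (rule orthogonal_transformation_linear)
  have meas[measurable]: "T \<in> borel_measurable borel"
    using lin by (intro borel_measurable_continuous_onI linear_continuous_on) (simp add: linear_linear)
  define B where "B = ball (0::'a) 1"
  have [measurable]: "B \<in> sets borel" by (simp add: B_def)
  have nrm: "norm (T x) = norm x" for x using T by (rule orthogonal_transformation_norm)
  have cball_meas: "emeasure lborel (ball c 1) = emeasure lborel B" for c :: 'a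
    unfolding B_def by (simp add: emeasure_ball)
  have "(\<integral>\<^sup>+y. \<integral>\<^sup>+x. indicator A (T x + y) * indicator B y \<partial>lborel \<partial>lborel)
      = (\<integral>\<^sup>+y. emeasure lborel (T -` A) * indicator B y \<partial>lborel)"
  proof (rule nn_integral_cong)
    fix y :: 'a
    \<comment> \<open>First evaluation: with \<open>y = T y'\<close> the integrand depends on
      \<open>T (y' + x)\<close>, so translating \<open>x\<close> removes \<open>y'\<close>.\<close>
    obtain y' where y': "y = T y'" using orthogonal_transformation_surj[OF T] by (metis surjD)
    have "(\<integral>\<^sup>+x. indicator A (T x + y) * indicator B y \<partial>lborel)
        = (\<integral>\<^sup>+x. indicator A (T (y' + x)) * indicator B y \<partial>lborel)"
      by (simp add: y' linear_add[OF lin] add.commute)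
    also have "\<dots> = (\<integral>\<^sup>+x. indicator A (T x) * indicator B y \<partial>lborel)"
      by (rule nn_integral_lborel_translate[where f="\<lambda>x. indicator A (T x) * indicator B y"]) measurable
    also have "\<dots> = (\<integral>\<^sup>+x. indicator (T -` A) x \<partial>lborel) * indicator B y"
      by (subst nn_integral_multc[symmetric]) (auto intro!: nn_integral_cong simp: indicator_def)
    also have "(\<integral>\<^sup>+x. indicator (T -` A) x \<partial>lborel) = emeasure lborel (T -` A)"
      by (rule nn_integral_indicator) (use measurable_sets_borel[OF meas A] in simp)
    finally show "(\<integral>\<^sup>+x. indicator A (T x + y) * indicator B y \<partial>lborel)
        = emeasure lborel (T -` A) * indicator B y" .
  qed
  then have 1: "(\<integral>\<^sup>+y. \<integral>\<^sup>+x. indicator A (T x + y) * indicator B y \<partial>lborel \<partial>lborel)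
      = emeasure lborel (T -` A) * emeasure lborel B"
    by (simp add: nn_integral_cmult)
  have "(\<integral>\<^sup>+y. \<integral>\<^sup>+x. indicator A (T x + y) * indicator B y \<partial>lborel \<partial>lborel)
      = (\<integral>\<^sup>+x. \<integral>\<^sup>+y. indicator A (T x + y) * indicator B y \<partial>lborel \<partial>lborel)"
    by (rule lborel_pair.Fubini') (simp add: split_beta', measurable)
  also have "\<dots> = (\<integral>\<^sup>+x. \<integral>\<^sup>+y. indicator A y * indicator B (y - T x) \<partial>lborel \<partial>lborel)"
  proof (rule nn_integral_cong)
    fix x :: 'a
    show "(\<integral>\<^sup>+y. indicator A (T x + y) * indicator B y \<partial>lborel)
      = (\<integral>\<^sup>+y. indicator A y * indicator B (y - T x) \<partial>lborel)"
      using nn_integral_lborel_translate[of "\<lambda>y. indicator A y * indicator B (y - T x)" "T x"] by simp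
  qed
  also have "\<dots> = (\<integral>\<^sup>+y. \<integral>\<^sup>+x. indicator A y * indicator B (y - T x) \<partial>lborel \<partial>lborel)"
    by (rule lborel_pair.Fubini') (simp add: split_beta', measurable)
  also have "\<dots> = (\<integral>\<^sup>+y. indicator A y * emeasure lborel B \<partial>lborel)"
  proof (rule nn_integral_cong)
    fix y :: 'a
    obtain y' where y': "y = T y'" using orthogonal_transformation_surj[OF T] by (metis surjD)
    \<comment> \<open>Second evaluation: \<open>T\<close> is an isometry, so the condition describes
      the unit ball about \<open>y'\<close>, whose volume does not depend on
      \<open>y'\<close>.\<close>
    have "(y - T x \<in> B) = (x \<in> ball y' 1)" for x
      using nrm[of "y' - x"] by (simp add: B_def y' dist_norm linear_diff[OF lin] norm_minus_commute)
    then have "(\<integral>\<^sup>+x. indicator A y * indicator B (y - T x) \<partial>lborel)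
        = (\<integral>\<^sup>+x. indicator A y * indicator (ball y' 1) x \<partial>lborel)"
      by (simp only: indicator_def)
    also have "\<dots> = indicator A y * emeasure lborel B"
      by (subst nn_integral_cmult_indicator) (simp_all add: cball_meas)
    finally show "(\<integral>\<^sup>+x. indicator A y * indicator B (y - T x) \<partial>lborel) = indicator A y * emeasure lborel B" .
  qed
  also have "\<dots> = emeasure lborel A * emeasure lborel B"
    by (simp add: nn_integral_multc)
  finally have "emeasure lborel (T -` A) * emeasure lborel B = emeasure lborel A * emeasure lborel B"
    using 1 by simp
  moreover have "emeasure lborel B \<noteq> 0" "emeasure lborel B \<noteq> top"
    using less_imp_neq[OF unit_ball_vol_pos[of "real DIM('a)"]] by (auto simp: B_def emeasure_ball)
  ultimately have "emeasure lborel (T -` A) = emeasure lborel A"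
    by (metis ennreal_mult_cancel_left mult.commute)
  then show "emeasure (distr lborel borel T) A = emeasure lborel A"
    by (simp add: emeasure_distr)
qed

section \<open>Rotations and complex lines in complex n-space\<close>

lemma norm_vector_scalar_mult:
  fixes v :: "complex ^ 'n"
  shows "norm (c *s v) = cmod c * norm v"
proof -
  have "norm (c *s v) = L2_set (\<lambda>i. cmod c * cmod (v $ i)) UNIV"
    by (simp add: norm_vec_def norm_mult)
  also have "\<dots> = cmod c * norm v"
    by (simp add: L2_set_right_distrib[symmetric] norm_vec_def)
  finally show ?thesis .
qed

lemma orthogonal_transformation_cis_scale:
  "orthogonal_transformation (\<lambda>v :: complex ^ 'n. cis t *s v)"
  unfolding orthogonal_transformation
  by (auto intro!: linearI simp: norm_vector_scalar_mult vec_eq_iff algebra_simps)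

lemma bounded_linear_scalar_mult_left: "bounded_linear (\<lambda>c. c *s (v :: complex ^ 'n))"
  by (rule bounded_linear_intro[where K="norm v"])
     (auto simp: norm_vector_scalar_mult vec_eq_iff algebra_simps)

text \<open>The chain rule gives the real derivative \<open>c \<mapsto> D (c *s v)\<close>; complex
  linearity of \<open>D\<close> turns it into multiplication by \<open>D v\<close>. One-variable
  theorems thus become available on every complex line.\<close>

lemma holomorphic_vec_on_slice:
  assumes f: "holomorphic_vec_on f \<Omega>" and S: "\<And>c. c \<in> S \<Longrightarrow> w + c *s v \<in> \<Omega>"
  shows "(\<lambda>c. f (w + c *s v)) holomorphic_on S"
proof (rule holomorphic_onI)
  fix c assume "c \<in> S"
  then obtain D where D: "(f has_derivative D) (at (w + c *s v))" "\<And>c v. D (c *s v) = c * D v"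
    using f S unfolding holomorphic_vec_on_def by blast
  have "((\<lambda>c. w + c *s v) has_derivative (\<lambda>c. c *s v)) (at c)"
    using bounded_linear_imp_has_derivative[OF bounded_linear_scalar_mult_left[of v], of "at c"]
    by (auto intro!: derivative_eq_intros)
  from has_derivative_compose[OF this D(1)] have "((\<lambda>c. f (w + c *s v)) has_field_derivative D v) (at c)"
    by (simp add: has_field_derivative_def D(2) mult.commute[of _ "D v"] mult_commute_abs)
  then show "(\<lambda>c. f (w + c *s v)) field_differentiable at c within S"
    using field_differentiable_def field_differentiable_at_within by blast
qed

lemma holomorphic_vec_on_continuous_on:
  assumes "holomorphic_vec_on f \<Omega>" shows "continuous_on \<Omega> f"
  using assms unfolding holomorphic_vec_on_def
  by (meson continuous_at_imp_continuous_on has_derivative_continuous)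

lemma continuous_on_scalar_mult [continuous_intros]:
  fixes g :: "'a::topological_space \<Rightarrow> complex ^ 'n"
  assumes "continuous_on S f" "continuous_on S g"
  shows "continuous_on S (\<lambda>x. f x *s g x)"
  unfolding vector_scalar_mult_def using assms by (intro continuous_intros)

text \<open>Cauchy's formula at the centre, with \<open>-\<i>\<close> cancelling the factor
  \<open>\<i>\<close> of the line element. Nonnegative integrals are used so that Tonelli applies
  directly.\<close>

lemma mean_value_circle:
  assumes "f holomorphic_on cball 0 1"
  shows "ennreal (2 * pi * cmod (f 0)) \<le> (\<integral>\<^sup>+t\<in>{0..2*pi}. ennreal (cmod (f (cis t))) \<partial>lborel)"
proof -
  have "((\<lambda>u. f u / (u - 0)) has_contour_integral 2 * of_real pi * \<i> * f 0) (circlepath 0 1)"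
    by (rule Cauchy_integral_circlepath_simple) (use assms in auto)
  then have "((\<lambda>t. f (cis t) * \<i>) has_integral 2 * of_real pi * \<i> * f 0) {0..2*pi}"
    by (simp add: circlepath_def has_contour_integral_part_circlepath_iff)
  from has_integral_mult_left[OF this, of "-\<i>"] have I: "((\<lambda>t. f (cis t)) has_integral 2 * of_real pi * f 0) {0..2*pi}"
    by (simp add: algebra_simps)
  have cont: "continuous_on {0..2*pi} (\<lambda>t. f (cis t))"
    by (rule continuous_on_compose2[OF holomorphic_on_imp_continuous_on[OF assms]])
       (auto intro!: continuous_intros)
  have J: "(\<lambda>t. cmod (f (cis t))) integrable_on {0..2*pi}"
    by (intro integrable_continuous_real continuous_intros cont)
  have "2 * pi * cmod (f 0) = cmod (integral {0..2*pi} (\<lambda>t. f (cis t)))"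
    using I by (simp add: integral_unique norm_mult)
  also have "\<dots> \<le> integral {0..2*pi} (\<lambda>t. cmod (f (cis t)))"
    by (rule integral_norm_bound_integral) (use I J in auto)
  finally have "ennreal (2 * pi * cmod (f 0)) \<le> ennreal (integral {0..2*pi} (\<lambda>t. cmod (f (cis t))))"
    by (rule ennreal_leI)
  also have "\<dots> = (\<integral>\<^sup>+t. ennreal (indicator {0..2*pi} t * cmod (f (cis t))) \<partial>lborel)"
    by (rule nn_integral_has_integral_lebesgue[symmetric]) (use J in auto)
  also have "\<dots> = (\<integral>\<^sup>+t\<in>{0..2*pi}. ennreal (cmod (f (cis t))) \<partial>lborel)"
    by (auto intro!: nn_integral_cong simp: indicator_def)
  finally show ?thesis .
qed

text \<open>Each circle \<open>t \<mapsto> w + cis t *s v\<close> satisfies the one-variable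
  inequality. Integrating over \<open>v\<close>, swapping by Tonelli and using rotation invariance
  of Lebesgue measure turns circle averages into the ball average.\<close>

lemma sub_mean_value_ball:
  fixes f :: "complex ^ 'n \<Rightarrow> complex"
  assumes f: "holomorphic_vec_on f \<Omega>" and ball: "ball w r \<subseteq> \<Omega>"
  shows "ennreal (cmod (f w)) * emeasure lborel (ball w r)
    \<le> (\<integral>\<^sup>+u\<in>ball w r. ennreal (cmod (f u)) \<partial>lborel)"
proof -
  \<comment> \<open>The ball is moved to the origin and \<open>f\<close> cut off outside it, so that
    rotations act on the whole space.\<close>
  define F where "F v = indicator (ball 0 r) v * ennreal (cmod (f (w + v)))" for v
  have cont: "continuous_on (ball 0 r) (\<lambda>v. cmod (f (w + v)))"
    using ball
    by (intro continuous_intros continuous_on_compose2[OF holomorphic_vec_on_continuous_on[OF f]])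
       (auto simp: dist_norm subset_iff)
  have "(\<lambda>v. indicator (ball 0 r) v *\<^sub>R (cmod (f (w + v)))) \<in> borel_measurable borel"
    by (rule borel_measurable_continuous_on_indicator[OF _ cont]) simp
  then have "(\<lambda>v. ennreal (indicator (ball 0 r) v *\<^sub>R (cmod (f (w + v))))) \<in> borel_measurable borel"
    by measurable
  also have "(\<lambda>v. ennreal (indicator (ball 0 r) v *\<^sub>R (cmod (f (w + v))))) = F"
    by (auto simp: F_def indicator_def)
  finally have [measurable]: "F \<in> borel_measurable borel" .
  have [measurable]: "(\<lambda>(t, v). cis t *s v) \<in> borel_measurable (borel \<Otimes>\<^sub>M (borel :: (complex ^ 'n) measure))"
    unfolding borel_prod
    by (rule borel_measurable_continuous_onI) (auto simp: split_beta' intro!: continuous_intros)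
  have [measurable]: "(\<lambda>v. cis t *s v) \<in> borel_measurable (borel :: (complex ^ 'n) measure)" for t
    by (rule borel_measurable_continuous_onI) (auto intro!: continuous_intros)
  have rot: "(\<integral>\<^sup>+v. F (cis t *s v) \<partial>lborel) = (\<integral>\<^sup>+v. F v \<partial>lborel)" for t
  proof -
    have "(\<integral>\<^sup>+v. F v \<partial>lborel) = (\<integral>\<^sup>+v. F v \<partial>distr lborel borel (\<lambda>v. cis t *s v))"
      by (simp add: lborel_distr_orthogonal orthogonal_transformation_cis_scale)
    also have "\<dots> = (\<integral>\<^sup>+v. F (cis t *s v) \<partial>lborel)"
      by (subst nn_integral_distr) auto
    finally show ?thesis ..
  qed
  have slice: "ennreal (2 * pi * cmod (f w)) * indicator (ball 0 r) v
      \<le> (\<integral>\<^sup>+t. F (cis t *s v) * indicator {0..2*pi} t \<partial>lborel)" for v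
  proof (cases "v \<in> ball 0 r")
    case True
    have "(\<lambda>c. f (w + c *s v)) holomorphic_on cball 0 1"
    proof (rule holomorphic_vec_on_slice[OF f])
      fix c :: complex assume "c \<in> cball 0 1"
      then have "norm (c *s v) \<le> 1 * norm v"
        unfolding norm_vector_scalar_mult by (intro mult_right_mono) auto
      then show "w + c *s v \<in> \<Omega>" using True ball by (auto simp: dist_norm subset_iff)
    qed
    from mean_value_circle[OF this] True show ?thesis
      by (simp add: F_def norm_vector_scalar_mult)
  qed simp
  have "ennreal (2 * pi) * (ennreal (cmod (f w)) * emeasure lborel (ball w r))
      = (\<integral>\<^sup>+v. ennreal (2 * pi * cmod (f w)) * indicator (ball 0 r) (v :: complex ^ 'n) \<partial>lborel)"
  proof -
    have "emeasure lborel (ball w r) = emeasure lborel (ball (0 :: complex ^ 'n) r)"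
      by (cases "r \<ge> 0") (simp_all add: emeasure_ball ball_empty)
    then show ?thesis
      by (subst nn_integral_cmult_indicator) (simp_all add: ennreal_mult' mult.assoc)
  qed
  also have "\<dots> \<le> (\<integral>\<^sup>+v. \<integral>\<^sup>+t. F (cis t *s v) * indicator {0..2*pi} t \<partial>lborel \<partial>lborel)"
    by (intro nn_integral_mono slice)
  also have "\<dots> = (\<integral>\<^sup>+t. \<integral>\<^sup>+v. F (cis t *s v) * indicator {0..2*pi} t \<partial>lborel \<partial>lborel)"
    by (rule lborel_pair.Fubini'[symmetric]) (simp add: split_beta', measurable)
  also have "\<dots> = (\<integral>\<^sup>+t. (\<integral>\<^sup>+v. F v \<partial>lborel) * indicator {0..2*pi} t \<partial>lborel)"
    by (simp add: nn_integral_multc rot)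
  also have "\<dots> = ennreal (2 * pi) * (\<integral>\<^sup>+v. F v \<partial>lborel)"
    by (simp add: nn_integral_cmult mult.commute)
  finally have "ennreal (cmod (f w)) * emeasure lborel (ball w r) \<le> (\<integral>\<^sup>+v. F v \<partial>lborel)"
    by (subst (asm) ennreal_mult_le_mult_iff) auto
  also have "\<dots> = (\<integral>\<^sup>+u. F (- w + u) \<partial>lborel)"
    by (rule nn_integral_lborel_translate[symmetric]) simp
  also have "\<dots> = (\<integral>\<^sup>+u\<in>ball w r. ennreal (cmod (f u)) \<partial>lborel)"
    by (auto intro!: nn_integral_cong simp: F_def indicator_def dist_norm norm_minus_commute)
  finally show ?thesis .
qed


section \<open>Uniform bounds from p-integrals\<close>

text \<open>Links the Bochner integral over \<open>lebesgue\<close>, which defines the space, with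
  the nonnegative integral over \<open>lborel\<close>, in which the sub-mean value property is
  stated.\<close>

lemma bergman_space_nn_integral:
  assumes "f \<in> bergman_space \<Omega> p"
  shows "(\<integral>\<^sup>+u\<in>\<Omega>. ennreal (cmod (f u) powr p) \<partial>lborel)
    = ennreal (LINT u:\<Omega>|lebesgue. cmod (f u) powr p)"
proof -
  have "ennreal (LINT u:\<Omega>|lebesgue. cmod (f u) powr p)
      = (\<integral>\<^sup>+u. ennreal (indicator \<Omega> u *\<^sub>R cmod (f u) powr p) \<partial>lebesgue)"
    unfolding set_lebesgue_integral_def
    by (rule nn_integral_eq_integral[symmetric])
       (use assms in \<open>auto simp: bergman_space_def set_integrable_def\<close>)
  also have "\<dots> = (\<integral>\<^sup>+u. ennreal (indicator \<Omega> u *\<^sub>R cmod (f u) powr p) \<partial>lborel)"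
    by (rule nn_integral_completion)
  also have "\<dots> = (\<integral>\<^sup>+u\<in>\<Omega>. ennreal (cmod (f u) powr p) \<partial>lborel)"
    by (auto intro!: nn_integral_cong simp: indicator_def)
  finally show ?thesis ..
qed

text \<open>
  For \<open>p < 1\<close> the sub-mean value property of \<open>|f|\<close> bounds \<open>|f(w)|\<close> only by
  \<open>\<integral>|f| \<le> sup |f|\<^sup>1\<^sup>-\<^sup>p \<integral>|f|\<^sup>p\<close>. Applied at a maximum point of \<open>|f(w)|\<close> times a power of the
  distance to the sphere, the supremum on the right is absorbed into the left-hand side.
\<close>
lemma sup_bound_half_ball:
  fixes f :: "complex ^ 'n \<Rightarrow> complex"
  defines "d \<equiv> DIM(complex ^ 'n)"
  assumes f: "f \<in> bergman_space \<Omega> p" and p: "1/2 \<le> p" "p \<le> 1"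
    and R: "0 < R" "R \<le> 1" and ball: "cball a R \<subseteq> \<Omega>"
    and C: "(LINT u:\<Omega>|lebesgue. cmod (f u) powr p) \<le> C"
    and w: "w \<in> ball a (R/2)"
  shows "cmod (f w) \<le> (1 + (2 ^ (2*d) * C / unit_ball_vol d)\<^sup>2) / (R/2) ^ (2*d)"
proof -
  have hol: "holomorphic_vec_on f \<Omega>" using f by (simp add: bergman_space_def)
  \<comment> \<open>With weight exponent \<open>2 * d\<close> the power of \<open>\<rho>\<close>
    left over below is \<open>d * (2 * p - 1)\<close>, nonnegative because
    \<open>p \<ge> 1/2\<close>.\<close>
  define N where "N = 2 * d"
  define K where "K = 2 ^ N * C / unit_ball_vol d"
  have d: "d > 0" by (simp add: d_def)
  have C0: "0 \<le> C"
    by (rule order_trans[OF _ C]) (auto simp: set_lebesgue_integral_def)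
  have K0: "0 \<le> K" using C0 by (simp add: K_def)
  define \<phi> where "\<phi> u = cmod (f u) * (R - dist a u) ^ N" for u
  have "continuous_on (cball a R) \<phi>"
    unfolding \<phi>_def
    by (intro continuous_intros continuous_on_subset[OF holomorphic_vec_on_continuous_on[OF hol]] ball)
  then obtain w0 where w0: "w0 \<in> cball a R" and max: "\<And>u. u \<in> cball a R \<Longrightarrow> \<phi> u \<le> \<phi> w0"
    using continuous_attains_sup[of "cball a R" \<phi>] R by auto
  define S where "S = \<phi> w0"
  have S0: "0 \<le> S" using w0 by (simp add: S_def \<phi>_def)
  have "S \<le> 1 + K\<^sup>2"
  proof (cases "S \<le> 1")
    case True then show ?thesis by (smt (verit) zero_le_power2)
  next
    case False
    \<comment> \<open>Half the distance from \<open>w0\<close> to the sphere: points of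
      \<open>ball w0 \<rho>\<close> keep distance at least \<open>\<rho>\<close> from the sphere, so
      maximality at \<open>w0\<close> bounds \<open>f\<close> there. \<open>S > 1\<close> excludes
      \<open>w0\<close> on the sphere, where the weight vanishes.\<close>
    define \<rho> where "\<rho> = (R - dist a w0) / 2"
    have "dist a w0 \<noteq> R" using False d by (auto simp: S_def \<phi>_def N_def power_0_left)
    then have \<rho>: "0 < \<rho>" "\<rho> \<le> 1" using w0 R zero_le_dist[of a w0] by (auto simp: \<rho>_def simp del: zero_le_dist)
    have dist: "dist a u \<le> R - \<rho>" if "u \<in> ball w0 \<rho>" for u
      using that dist_triangle[of a u w0] by (simp add: \<rho>_def field_simps)
    then have sub: "ball w0 \<rho> \<subseteq> \<Omega>"
      using ball \<rho> by (smt (verit) mem_cball subset_iff)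
    have fu: "cmod (f u) \<le> S / \<rho> ^ N" if u: "u \<in> ball w0 \<rho>" for u
    proof -
      have "cmod (f u) * \<rho> ^ N \<le> \<phi> u"
        unfolding \<phi>_def using dist[OF u] \<rho> by (intro mult_left_mono power_mono) auto
      also have "\<dots> \<le> S"
        unfolding S_def using dist[OF u] \<rho> by (intro max) auto
      finally show ?thesis using \<rho> by (simp add: field_simps)
    qed
    define B where "B = (S / \<rho> ^ N) powr (1 - p)"
    have "ennreal (cmod (f w0)) * emeasure lborel (ball w0 \<rho>)
        \<le> (\<integral>\<^sup>+u\<in>ball w0 \<rho>. ennreal (cmod (f u)) \<partial>lborel)"
      by (rule sub_mean_value_ball[OF hol sub])
    also have "\<dots> \<le> (\<integral>\<^sup>+u. ennreal B * (ennreal (cmod (f u) powr p) * indicator \<Omega> u) \<partial>lborel)"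
    proof (rule nn_integral_mono)
      fix u
      show "ennreal (cmod (f u)) * indicator (ball w0 \<rho>) u
          \<le> ennreal B * (ennreal (cmod (f u) powr p) * indicator \<Omega> u)"
      proof (cases "u \<in> ball w0 \<rho>")
        case True
        have "cmod (f u) = cmod (f u) powr (1 - p) * cmod (f u) powr p"
          unfolding powr_add[symmetric] by simp
        also have "\<dots> \<le> B * cmod (f u) powr p"
          unfolding B_def using fu[OF True] p by (intro mult_right_mono powr_mono2) auto
        finally have "ennreal (cmod (f u)) \<le> ennreal B * ennreal (cmod (f u) powr p)"
          by (metis B_def ennreal_leI ennreal_mult' powr_ge_zero)
        then show ?thesis using True sub by auto
      qed simp
    qed
    \<comment> \<open>Integrability gives measurability for the completed measure, so the constant
      is pulled out there.\<close>
    also have "\<dots> = ennreal B * (\<integral>\<^sup>+u\<in>\<Omega>. ennreal (cmod (f u) powr p) \<partial>lebesgue)"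
    proof -
      have m: "(\<lambda>u. ennreal (cmod (f u) powr p) * indicator \<Omega> u) \<in> borel_measurable lebesgue"
      proof -
        have "(\<lambda>u. indicator \<Omega> u *\<^sub>R cmod (f u) powr p) \<in> borel_measurable lebesgue"
          using f by (auto simp: bergman_space_def set_integrable_def)
        then have "(\<lambda>u. ennreal (indicator \<Omega> u *\<^sub>R cmod (f u) powr p)) \<in> borel_measurable lebesgue"
          by measurable
        then show ?thesis
          by (rule back_subst[where P="\<lambda>f. f \<in> _"]) (auto simp: indicator_def)
      qed
      show ?thesis
        by (subst nn_integral_completion[symmetric], subst nn_integral_cmult[OF m]) (rule refl)
    qed
    also have "\<dots> = ennreal B * ennreal (LINT u:\<Omega>|lebesgue. cmod (f u) powr p)"
      by (simp only: nn_integral_completion bergman_space_nn_integral[OF f])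
    also have "\<dots> \<le> ennreal (B * C)"
      using C C0 by (simp add: B_def ennreal_mult' mult_left_mono ennreal_leI)
    also have "ennreal (cmod (f w0)) * emeasure lborel (ball w0 \<rho>)
        = ennreal (cmod (f w0) * (unit_ball_vol d * \<rho> ^ d))"
      using \<rho> by (simp add: emeasure_ball d_def ennreal_mult')
    finally have *: "cmod (f w0) * (unit_ball_vol d * \<rho> ^ d) \<le> B * C"
      using C0 by (simp add: B_def)
    have "cmod (f w0) \<le> B * C / (unit_ball_vol d * \<rho> ^ d)"
      using * \<rho> by (simp add: pos_le_divide_eq)
    moreover have "S = cmod (f w0) * (2 * \<rho>) ^ N" by (auto simp: S_def \<phi>_def \<rho>_def diff_divide_distrib)
    moreover have "0 \<le> (2 * \<rho>) ^ N" using \<rho> by simp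
    ultimately have "S \<le> B * C / (unit_ball_vol d * \<rho> ^ d) * (2 * \<rho>) ^ N"
      by (metis mult_right_mono)
    also have "\<dots> = K * (B * \<rho> ^ d)"
    proof -
      have "(2 * \<rho>) ^ N = 2 ^ N * (\<rho> ^ d * \<rho> ^ d)"
        by (simp add: N_def power_mult_distrib power_mult power2_eq_square)
      then show ?thesis using \<rho> by (simp add: K_def)
    qed
    also have "B * \<rho> ^ d = S powr (1 - p) * (\<rho> powr (- real N * (1 - p)) * \<rho> powr real d)"
    proof -
      have "\<rho> ^ N = \<rho> powr real N" "\<rho> ^ d = \<rho> powr real d" using \<rho> by (simp_all add: powr_realpow)
      then show ?thesis using \<rho> S0 by (simp add: B_def powr_divide powr_powr powr_minus_divide)
    qed
    also have "\<rho> powr (- real N * (1 - p)) * \<rho> powr real d = \<rho> powr (real d * (2 * p - 1))"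
      unfolding powr_add[symmetric] by (simp add: N_def algebra_simps)
    also have "K * (S powr (1 - p) * \<dots>) \<le> K * (S powr (1 - p) * 1)"
      using \<rho> p K0 by (intro mult_left_mono powr_le1) auto
    finally have "S powr p * S powr (1 - p) \<le> K * S powr (1 - p)"
      using False unfolding powr_add[symmetric] by simp
    \<comment> \<open>Cancelling \<open>S powr (1 - p)\<close> absorbs the supremum;
      \<open>S > 1\<close> and \<open>p \<ge> 1/2\<close> then make the bound independent of
      \<open>p\<close>.\<close>
    then have "S powr p \<le> K" using False by simp
    moreover have "S powr (1/2) \<le> S powr p" using False p by (intro powr_mono) auto
    ultimately have "sqrt S \<le> K" by (simp add: powr_half_sqrt S0)
    then have "S \<le> K\<^sup>2" by (metis S0 real_sqrt_ge_zero real_sqrt_pow2 power_mono)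
    then show ?thesis by simp
  qed
  moreover have "cmod (f w) * (R/2) ^ N \<le> S"
  proof -
    have "cmod (f w) * (R/2) ^ N \<le> \<phi> w"
      unfolding \<phi>_def using w R by (intro mult_left_mono power_mono) auto
    also have "\<dots> \<le> S" unfolding S_def using w R by (intro max) auto
    finally show ?thesis .
  qed
  ultimately have "cmod (f w) * (R/2) ^ N \<le> 1 + K\<^sup>2" by simp
  then show ?thesis unfolding N_def[symmetric] K_def using R by (simp add: pos_le_divide_eq)
qed

text \<open>Compactness gives one radius for all centres in \<open>K\<close>, and the half-ball
  bound depends only on this radius, the dimension and \<open>C\<close>.\<close>

lemma bergman_bounded_on_compact:
  fixes \<Omega> :: "(complex ^ 'n) set"
  assumes "open \<Omega>" "compact K" "K \<subseteq> \<Omega>"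
  obtains B where
    "\<And>f p w. \<lbrakk>f \<in> bergman_space \<Omega> p; 1/2 \<le> p; p \<le> 1;
       (LINT u:\<Omega>|lebesgue. cmod (f u) powr p) \<le> C; w \<in> K\<rbrakk> \<Longrightarrow> cmod (f w) \<le> B"
proof -
  obtain e where e: "e > 0" "(\<Union>a\<in>K. cball a e) \<subseteq> \<Omega>"
    using compact_subset_open_imp_cball_epsilon_subset assms by metis
  define R where "R = min e 1"
  have R: "0 < R" "R \<le> 1" using e(1) by (auto simp: R_def)
  have "cball a R \<subseteq> \<Omega>" if "a \<in> K" for a
    using e(2) that by (force simp: R_def)
  note bound = sup_bound_half_ball[OF _ _ _ R this]
  show thesis
  proof (rule that)
    fix f p w
    assume "f \<in> bergman_space \<Omega> p" "1/2 \<le> p" "p \<le> 1" "w \<in> K"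
      "(LINT u:\<Omega>|lebesgue. cmod (f u) powr p) \<le> C"
    then show "cmod (f w) \<le> (1 + (2 ^ (2 * DIM(complex ^ 'n)) * C
        / unit_ball_vol DIM(complex ^ 'n))\<^sup>2) / (R/2) ^ (2 * DIM(complex ^ 'n))"
      using R by (intro bound) auto
  qed
qed


section \<open>Pointwise limits of locally bounded sequences\<close>

text \<open>
  Pointwise limits of holomorphic functions of several variables are only shown to be holomorphic
  along complex lines; this is all the identity theorem below needs, and it avoids Hartogs-type
  arguments.
\<close>
definition slice_holomorphic_on :: "(complex ^ 'n \<Rightarrow> complex) \<Rightarrow> (complex ^ 'n) set \<Rightarrow> bool" where
  "slice_holomorphic_on f \<Omega> \<longleftrightarrow>
     (\<forall>w v S. open S \<and> (\<forall>c\<in>S. w + c *s v \<in> \<Omega>) \<longrightarrow> (\<lambda>c. f (w + c *s v)) holomorphic_on S)"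

lemma slice_holomorphic_onD:
  assumes "slice_holomorphic_on f \<Omega>" "open S" "\<And>c. c \<in> S \<Longrightarrow> w + c *s v \<in> \<Omega>"
  shows "(\<lambda>c. f (w + c *s v)) holomorphic_on S"
  using assms unfolding slice_holomorphic_on_def by blast

lemma slice_in_ball:
  fixes v :: "complex ^ 'n"
  assumes "norm v \<le> r" "c \<in> ball 0 1" "0 < r"
  shows "a + c *s v \<in> ball a r"
proof -
  have "cmod c * norm v \<le> cmod c * r" using assms by (intro mult_left_mono) auto
  also have "\<dots> < r" using assms by simp
  finally show ?thesis by (simp add: dist_norm norm_vector_scalar_mult)
qed

text \<open>The direction \<open>v\<close> points from \<open>a\<close> to \<open>w\<close> and is
  scaled to length \<open>r\<close>. Together with \<open>slice_in_ball\<close> this reduces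
  statements on balls to the unit disc.\<close>

lemma ball_slice:
  fixes a w :: "complex ^ 'n"
  assumes "w \<in> ball a r" "0 < r"
  obtains c v where "w = a + c *s v" "norm v \<le> r" "cmod c = dist a w / r" "c \<in> ball 0 1"
proof (cases "w = a")
  case True
  then show ?thesis using that[of 0 0] assms by simp
next
  case False
  define v where "v = complex_of_real (r / dist a w) *s (w - a)"
  have "w = a + complex_of_real (dist a w / r) *s v"
    using False assms by (simp add: v_def vec_eq_iff)
  moreover have "norm v \<le> r"
    using False assms unfolding v_def norm_vector_scalar_mult
    by (simp add: dist_norm norm_minus_commute norm_divide)
  ultimately show ?thesis
    using assms by (intro that[of "complex_of_real (dist a w / r)" v]) (auto simp: norm_divide)
qed

text \<open>One-variable Schwarz lemma on the disc through \<open>a\<close> and \<open>w\<close>.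
  Only \<open>B\<close> and \<open>r\<close> enter the constant, so a locally bounded family is
  equicontinuous.\<close>

lemma holomorphic_vec_on_schwarz:
  fixes f :: "complex ^ 'n \<Rightarrow> complex"
  assumes f: "holomorphic_vec_on f \<Omega>" and r: "ball a r \<subseteq> \<Omega>" "0 < r"
    and B: "\<And>w. w \<in> ball a r \<Longrightarrow> cmod (f w) \<le> B" and w: "w \<in> ball a r"
  shows "cmod (f w - f a) \<le> (2 * B + 1) / r * dist a w"
proof -
  have B0: "0 \<le> B" using B[of a] r by (metis centre_in_ball norm_ge_zero order_trans)
  obtain c v where cv: "w = a + c *s v" "norm v \<le> r" "cmod c = dist a w / r" "c \<in> ball 0 1"
    using ball_slice[OF w r(2)] .
  \<comment> \<open>The summand 1 makes the bound strict, so \<open>h\<close> maps into the open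
    unit disc even when \<open>B = 0\<close>.\<close>
  define M where "M = 2 * B + 1"
  have M: "M > 0" "2 * B < M" using B0 by (auto simp: M_def)
  define h where "h c = (f (a + c *s v) - f a) / complex_of_real M" for c
  have "h holomorphic_on ball 0 1"
    unfolding h_def using slice_in_ball[OF cv(2) _ r(2)] r(1) M
    by (intro holomorphic_intros holomorphic_vec_on_slice[OF f]) auto
  moreover have "cmod (h c) < 1" if "cmod c < 1" for c
  proof -
    have "a + c *s v \<in> ball a r" using that by (intro slice_in_ball[OF cv(2) _ r(2)]) simp
    then have "cmod (f (a + c *s v) - f a) \<le> 2 * B"
      using B[of a] B[of "a + c *s v"] r norm_triangle_ineq4[of "f (a + c *s v)" "f a"] by simp
    then show ?thesis using M by (simp add: h_def norm_divide divide_less_eq)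
  qed
  moreover have "h 0 = 0" by (simp add: h_def)
  ultimately have "cmod (h c) \<le> cmod c"
    using cv(4) by (intro Schwarz_Lemma(1)) auto
  then have "cmod (f w - f a) / M \<le> dist a w / r"
    using M by (simp add: h_def norm_divide cv(1)[symmetric] cv(3))
  then show ?thesis
    using M r(2) unfolding M_def[symmetric] by (simp add: field_simps)
qed

lemma eventually_small_linear:
  fixes r :: real
  assumes "0 < r" "0 < e"
  obtains d where "0 < d" "d \<le> r" "\<And>t. 0 \<le> t \<Longrightarrow> t < d \<Longrightarrow> K * t < e"
proof (rule that[of "min r (e / (\<bar>K\<bar> + 1))"])
  fix t :: real assume t: "0 \<le> t" "t < min r (e / (\<bar>K\<bar> + 1))"
  then have "t * (\<bar>K\<bar> + 1) < e" by (auto simp: pos_less_divide_eq)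
  moreover have "K * t \<le> (\<bar>K\<bar> + 1) * t"
    using t abs_ge_self[of K] by (intro mult_right_mono) auto
  ultimately show "K * t < e" by (simp add: mult.commute)
qed (use assms in auto)

section \<open>Compactness of locally bounded holomorphic sequences\<close>

locale locally_bounded_sequence =
  fixes F :: "nat \<Rightarrow> complex ^ 'n \<Rightarrow> complex" and \<Omega> :: "(complex ^ 'n) set"
  assumes hol: "\<And>n. holomorphic_vec_on (F n) \<Omega>"
    and bounded: "\<And>K. compact K \<Longrightarrow> K \<subseteq> \<Omega> \<Longrightarrow> \<exists>B. \<forall>n. \<forall>w\<in>K. cmod (F n w) \<le> B"
    and open_domain: "open \<Omega>"
begin

lemma equi_lipschitz:
  assumes "a \<in> \<Omega>"
  shows "\<exists>r>0. \<exists>K. ball a r \<subseteq> \<Omega> \<and>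
    (\<forall>n. \<forall>w\<in>ball a r. cmod (F n w - F n a) \<le> K * dist a w)"
proof -
  obtain r where r: "0 < r" "cball a r \<subseteq> \<Omega>" using assms open_domain open_contains_cball by blast
  obtain B where B: "\<And>n w. w \<in> cball a r \<Longrightarrow> cmod (F n w) \<le> B"
    using bounded[OF compact_cball r(2)] by blast
  have sub: "ball a r \<subseteq> \<Omega>" using r by (meson ball_subset_cball order_trans)
  have "cmod (F n w - F n a) \<le> (2 * B + 1) / r * dist a w" if "w \<in> ball a r" for n w
    using that B by (intro holomorphic_vec_on_schwarz[OF hol sub r(1)]) auto
  then show ?thesis using r(1) sub by blast
qed

text \<open>Arzela-Ascoli in pointwise form: a diagonal subsequence converges on a countable dense
  set, and Lipschitz bounds uniform in \<open>n\<close> carry the Cauchy property to every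
  point.\<close>

lemma pointwise_convergent_subsequence:
  obtains k where "strict_mono (k :: nat \<Rightarrow> nat)" "\<And>w. w \<in> \<Omega> \<Longrightarrow> convergent (\<lambda>n. F (k n) w)"
proof -
  obtain D :: "(complex ^ 'n) set" where D: "countable D" "\<And>X. open X \<Longrightarrow> X \<noteq> {} \<Longrightarrow> \<exists>d\<in>D. d \<in> X"
    using countable_dense_exists by metis
  have "\<exists>M. \<forall>n. cmod (F n w) \<le> M" if "w \<in> \<Omega>" for w
    using bounded[of "{w}"] that by auto
  then obtain M where M: "\<And>n w. w \<in> \<Omega> \<Longrightarrow> cmod (F n w) \<le> M w" by metis
  \<comment> \<open>Division by \<open>N\<close> brings the bounds \<open>M w\<close>, which vary
    with \<open>w\<close>, to the common bound 1; the maximum keeps the divisor positive.\<close>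
  define N where "N w = max 1 (M w)" for w
  have N: "N w > 0" for w by (simp add: N_def)
  obtain k where k: "strict_mono (k :: nat \<Rightarrow> nat)"
    "\<And>x. x \<in> D \<inter> \<Omega> \<Longrightarrow> \<exists>l. (\<lambda>n. F (k n) x / complex_of_real (N x)) \<longlonglongrightarrow> l"
  proof (rule function_convergent_subsequence[of "D \<inter> \<Omega>" "\<lambda>n x. F n x / complex_of_real (N x)" 1])
    show "countable (D \<inter> \<Omega>)" using D by blast
    show "cmod (F n x / complex_of_real (N x)) \<le> 1" if "x \<in> D \<inter> \<Omega>" for n x
      using M[of x n] that N[of x] by (simp add: norm_divide) (simp add: N_def)
  qed blast
  have dense: "convergent (\<lambda>n. F (k n) x)" if x: "x \<in> D" "x \<in> \<Omega>" for x
  proof -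
    obtain l where "(\<lambda>n. F (k n) x / complex_of_real (N x)) \<longlonglongrightarrow> l" using k(2) x by blast
    from tendsto_mult[OF this tendsto_const[of "complex_of_real (N x)"]] show ?thesis
      using N[of x] by (auto simp: convergent_def)
  qed
  show thesis
  proof (rule that[OF k(1)])
    fix a assume a: "a \<in> \<Omega>"
    obtain r K where r: "0 < r" "ball a r \<subseteq> \<Omega>"
      and K: "\<And>n w. w \<in> ball a r \<Longrightarrow> cmod (F n w - F n a) \<le> K * dist a w"
      using equi_lipschitz[OF a] by blast
    have "Cauchy (\<lambda>n. F (k n) a)"
    proof (rule metric_CauchyI)
      fix e :: real assume "0 < e"
      then obtain d where d: "0 < d" "d \<le> r" "\<And>t. 0 \<le> t \<Longrightarrow> t < d \<Longrightarrow> K * t < e/3"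
        using eventually_small_linear[of r "e/3" K] r by auto
      obtain x where x: "x \<in> D" "x \<in> ball a d" using D(2)[of "ball a d"] d by auto
      have xr: "x \<in> ball a r" using x d by auto
      have close: "cmod (F n x - F n a) < e/3" for n
        using K[OF xr, of n] d(3)[of "dist a x"] x by simp
      have "Cauchy (\<lambda>n. F (k n) x)" using dense[of x] x xr r Cauchy_convergent_iff by blast
      then obtain L where L: "\<And>m n. m \<ge> L \<Longrightarrow> n \<ge> L \<Longrightarrow> dist (F (k m) x) (F (k n) x) < e/3"
        using metric_CauchyD[of _ "e/3"] \<open>0 < e\<close> by (metis divide_pos_pos zero_less_numeral)
      have "dist (F (k m) a) (F (k n) a) < e" if "m \<ge> L" "n \<ge> L" for m n
      proof -
        have "dist (F (k m) a) (F (k n) a)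
            \<le> dist (F (k m) a) (F (k m) x) + dist (F (k m) x) (F (k n) x) + dist (F (k n) x) (F (k n) a)"
          using dist_triangle[of "F (k m) a" "F (k n) a" "F (k m) x"]
            dist_triangle[of "F (k m) x" "F (k n) a" "F (k n) x"] by linarith
        also have "\<dots> < e/3 + e/3 + e/3"
          using close[of "k m"] close[of "k n"] L[OF that] by (simp add: dist_norm norm_minus_commute)
        finally show ?thesis by simp
      qed
      then show "\<exists>L. \<forall>m\<ge>L. \<forall>n\<ge>L. dist (F (k m) a) (F (k n) a) < e" by blast
    qed
    then show "convergent (\<lambda>n. F (k n) a)" using Cauchy_convergent_iff by blast
  qed
qed

text \<open>On each slice Montel's theorem yields a subsequence with a holomorphic limit, which must
  be the given pointwise limit.\<close>

lemma limit_slice_holomorphic: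
  assumes lim: "\<And>w. w \<in> \<Omega> \<Longrightarrow> (\<lambda>n. F n w) \<longlonglongrightarrow> G w"
  shows "slice_holomorphic_on G \<Omega>"
  unfolding slice_holomorphic_on_def
proof safe
  fix w v and S :: "complex set"
  assume S: "open S" "\<forall>c\<in>S. w + c *s v \<in> \<Omega>"
  define h where "h n c = F n (w + c *s v)" for n c
  have h: "h n holomorphic_on S" for n
    unfolding h_def using S by (intro holomorphic_vec_on_slice[OF hol]) auto
  have b: "\<exists>B. \<forall>g\<in>range h. \<forall>c\<in>K. cmod (g c) \<le> B" if K: "compact K" "K \<subseteq> S" for K
  proof -
    have "compact ((\<lambda>c. w + c *s v) ` K)"
      using K by (intro compact_continuous_image continuous_intros)
    from bounded[OF this] S K show ?thesis by (fastforce simp: h_def)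
  qed
  obtain g r where g: "g holomorphic_on S" "strict_mono (r :: nat \<Rightarrow> nat)"
    "\<And>x. x \<in> S \<Longrightarrow> (\<lambda>n. h (r n) x) \<longlonglongrightarrow> g x"
  proof (rule Montel[of S "range h" h])
    show "\<And>g. g \<in> range h \<Longrightarrow> g holomorphic_on S" using h by auto
  qed (use S(1) b in auto)
  have "g c = G (w + c *s v)" if "c \<in> S" for c
  proof (rule LIMSEQ_unique[OF g(3)[OF that]])
    show "(\<lambda>n. h (r n) c) \<longlonglongrightarrow> G (w + c *s v)"
      using LIMSEQ_subseq_LIMSEQ[OF lim g(2), of "w + c *s v"] S that by (auto simp: h_def o_def)
  qed
  then show "(\<lambda>c. G (w + c *s v)) holomorphic_on S"
    by (rule holomorphic_transform[OF g(1)])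
qed

text \<open>The Lipschitz estimate, uniform in \<open>n\<close>, survives the pointwise
  limit.\<close>

lemma limit_continuous:
  assumes lim: "\<And>w. w \<in> \<Omega> \<Longrightarrow> (\<lambda>n. F n w) \<longlonglongrightarrow> G w"
  shows "continuous_on \<Omega> G"
proof (rule continuous_at_imp_continuous_on, rule ballI)
  fix a assume a: "a \<in> \<Omega>"
  obtain r K where r: "0 < r" "ball a r \<subseteq> \<Omega>"
    and K: "\<And>n w. w \<in> ball a r \<Longrightarrow> cmod (F n w - F n a) \<le> K * dist a w"
    using equi_lipschitz[OF a] by blast
  have G: "cmod (G w - G a) \<le> K * dist a w" if "w \<in> ball a r" for w
    by (rule LIMSEQ_le_const2[OF tendsto_norm[OF tendsto_diff[OF lim lim]]])
       (use that a r K in auto)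
  show "isCont G a"
  proof (rule continuous_at_eps_delta[THEN iffD2], safe)
    fix e :: real assume "0 < e"
    then obtain d where d: "0 < d" "d \<le> r" "\<And>t. 0 \<le> t \<Longrightarrow> t < d \<Longrightarrow> K * t < e"
      using eventually_small_linear[OF r(1), of e K] by auto
    have "dist (G w) (G a) < e" if "dist w a < d" for w
    proof -
      have "cmod (G w - G a) \<le> K * dist a w" using that d by (intro G) (simp add: dist_commute)
      also have "\<dots> < e" using that by (intro d) (simp_all add: dist_commute)
      finally show ?thesis by (simp add: dist_norm)
    qed
    then show "\<exists>d>0. \<forall>w. dist w a < d \<longrightarrow> dist (G w) (G a) < e" using d by blast
  qed
qed

end

section \<open>Identity theorem and rigidity along complex lines\<close>

lemma real_valued_holomorphic_constant:
  assumes "f holomorphic_on S" "open S" "connected S" "f ` S \<subseteq> \<real>"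
  shows "f constant_on S"
proof (rule ccontr)
  assume nc: "\<not> f constant_on S"
  \<comment> \<open>Open mapping theorem: a nonconstant \<open>f\<close> has an open image, whereas
    a set of real numbers has empty interior in the plane.\<close>
  then have "open (f ` S)" using assms open_mapping_thm by blast
  moreover have "interior (\<real> :: complex set) = {}"
  proof -
    have "False" if e: "e > 0" "ball x e \<subseteq> (\<real> :: complex set)" for x e
    proof -
      have "x \<in> \<real>" "x + of_real (e/2) * \<i> \<in> \<real>"
        using e by (auto intro!: subsetD[OF e(2)] simp: dist_norm norm_mult)
      then have "of_real (e/2) * \<i> \<in> \<real>" by (metis Reals_diff add_diff_cancel_left')
      then show False using e by (simp add: complex_is_Real_iff)
    qed
    then show ?thesis by (metis all_not_in_conv mem_interior)
  qed
  ultimately have "f ` S = {}" using assms(4) by (metis interior_maximal subset_empty)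
  then show False using nc by (auto simp: constant_on_def)
qed

text \<open>The points near which \<open>f = g\<close> form a clopen set: around a limit point
  \<open>b\<close>, every point lies on a complex disc centred at a nearby \<open>a\<close> of the
  set, and one-variable continuation applies on that disc.\<close>

lemma slice_holomorphic_identity:
  fixes f g :: "complex ^ 'n \<Rightarrow> complex"
  assumes f: "slice_holomorphic_on f \<Omega>" and g: "slice_holomorphic_on g \<Omega>"
    and \<Omega>: "open \<Omega>" "connected \<Omega>"
    and r: "0 < r" "ball z r \<subseteq> \<Omega>" "\<And>w. w \<in> ball z r \<Longrightarrow> f w = g w"
    and w: "w \<in> \<Omega>"
  shows "f w = g w"
proof -
  define U where "U = \<Omega> \<inter> interior {w. f w = g w}"
  have "z \<in> U" using r unfolding U_def by (auto simp: mem_interior)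
  have "openin (top_of_set \<Omega>) U"
    unfolding U_def by (intro openin_open_Int) simp
  moreover have "closedin (top_of_set \<Omega>) U"
    unfolding closedin_limpt
  proof safe
    fix b assume b: "b islimpt U" "b \<in> \<Omega>"
    obtain s where s: "0 < s" "ball b s \<subseteq> \<Omega>" using b \<Omega> open_contains_ball by blast
    \<comment> \<open>Distance below \<open>s/2\<close> makes \<open>ball a (s/2)\<close> contain
      \<open>b\<close> and stay inside \<open>ball b s\<close>.\<close>
    obtain a where a: "a \<in> U" "dist a b < s/2" using b(1) s(1) by (metis islimpt_approachable half_gt_zero)
    obtain t where t: "0 < t" "ball a t \<subseteq> {w. f w = g w}" using a(1) by (auto simp: U_def mem_interior)
    have sub: "ball a (s/2) \<subseteq> \<Omega>"
    proof
      fix u assume "u \<in> ball a (s/2)"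
      then have "dist b u < s" using a(2) dist_triangle[of b u a] by (simp add: dist_commute)
      then show "u \<in> \<Omega>" using s by auto
    qed
    have eq: "f u = g u" if u: "u \<in> ball a (s/2)" for u
    proof -
      obtain c v where cv: "u = a + c *s v" "norm v \<le> s/2" "c \<in> ball 0 1"
        using ball_slice[OF u half_gt_zero[OF s(1)]] by metis
      have in\<Omega>: "a + c *s v \<in> \<Omega>" if "c \<in> ball 0 1" for c
        using slice_in_ball[OF cv(2) that] s sub by auto
      \<comment> \<open>On the disc of radius \<open>\<tau>\<close> the line stays in
        \<open>ball a t\<close>, where \<open>f = g\<close>; adding 1 covers
        \<open>v = 0\<close>.\<close>
      define \<tau> where "\<tau> = min 1 (t / (norm v + 1))"
      have nv: "norm v + 1 > 0" by (simp add: add_nonneg_pos)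
      have \<tau>: "0 < \<tau>" "\<tau> \<le> 1" using t nv by (auto simp: \<tau>_def)
      have near: "f (a + c *s v) = g (a + c *s v)" if "c \<in> ball 0 \<tau>" for c
      proof -
        have "cmod c * norm v \<le> cmod c * (norm v + 1)" by (intro mult_left_mono) auto
        also have "\<dots> < t" using that nv by (auto simp: \<tau>_def pos_less_divide_eq)
        finally have "a + c *s v \<in> ball a t" by (simp add: dist_norm norm_vector_scalar_mult)
        then show ?thesis using t by blast
      qed
      have "f (a + c *s v) = g (a + c *s v)"
        by (rule analytic_continuation_open[of "ball 0 \<tau>" "ball 0 1" "\<lambda>c. f (a + c *s v)" "\<lambda>c. g (a + c *s v)"])
           (use \<tau> cv near in \<open>auto intro!: slice_holomorphic_onD[OF f] slice_holomorphic_onD[OF g] in\<Omega>\<close>)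
      then show ?thesis using cv by simp
    qed
    have "b \<in> interior {w. f w = g w}"
      by (rule interiorI[of "ball a (s/2)"]) (use a eq in \<open>auto simp: dist_commute\<close>)
    then show "b \<in> U" using b by (simp add: U_def)
  qed (auto simp: U_def)
  ultimately have "U = \<Omega>" using \<Omega>(2) \<open>z \<in> U\<close> unfolding connected_clopen by blast
  then show ?thesis using w interior_subset unfolding U_def by blast
qed

text \<open>Equality in the triangle inequality makes \<open>f / g\<close> real where
  \<open>g\<close> is nonzero. On discs through \<open>z\<close> in a zero-free ball it is therefore
  constant, with value 1 taken at \<open>z\<close>.\<close>

lemma slice_holomorphic_eq_of_norm_add:
  fixes f g :: "complex ^ 'n \<Rightarrow> complex"
  assumes f: "slice_holomorphic_on f \<Omega>" and g: "slice_holomorphic_on g \<Omega>"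
    and cont: "continuous_on \<Omega> g"
    and \<Omega>: "open \<Omega>" "connected \<Omega>" and z: "z \<in> \<Omega>" "f z = 1" "g z = 1"
    and add: "\<And>w. w \<in> \<Omega> \<Longrightarrow> cmod (f w + g w) = cmod (f w) + cmod (g w)"
    and w: "w \<in> \<Omega>"
  shows "f w = g w"
proof -
  have "isCont g z" using cont \<Omega> z by (simp add: continuous_on_eq_continuous_at)
  then obtain r1 where r1: "r1 > 0" "\<And>w. dist z w < r1 \<Longrightarrow> g w \<noteq> 0"
    using continuous_at_avoid[of z g 0] z by auto
  obtain r2 where r2: "r2 > 0" "ball z r2 \<subseteq> \<Omega>" using \<Omega> z open_contains_ball by blast
  define r where "r = min r1 r2"
  have r: "0 < r" "ball z r \<subseteq> \<Omega>" "\<And>w. w \<in> ball z r \<Longrightarrow> g w \<noteq> 0"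
    using r1 r2 by (auto simp: r_def)
  have "f u = g u" if u: "u \<in> ball z r" for u
  proof -
    obtain c v where cv: "u = z + c *s v" "norm v \<le> r" "c \<in> ball 0 1"
      using ball_slice[OF u r(1)] by metis
    note in_ball = slice_in_ball[OF cv(2) _ r(1)]
    define h where "h c = f (z + c *s v) / g (z + c *s v)" for c
    have "h holomorphic_on ball 0 1"
      unfolding h_def using in_ball r
      by (intro holomorphic_on_divide slice_holomorphic_onD[OF f] slice_holomorphic_onD[OF g]) auto
    moreover have "h ` ball 0 1 \<subseteq> \<real>"
    proof safe
      fix c :: complex assume "c \<in> ball 0 1"
      define w where "w = z + c *s v"
      have w: "w \<in> \<Omega>" "g w \<noteq> 0" using in_ball[OF \<open>c \<in> ball 0 1\<close>] r by (auto simp: w_def)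
      from add[OF w(1)] have "cmod (f w) *\<^sub>R g w = cmod (g w) *\<^sub>R f w"
        by (simp add: norm_triangle_eq)
      then have "f w / g w = complex_of_real (cmod (f w) / cmod (g w))"
        using w(2) by (simp add: scaleR_conv_of_real field_simps)
      then show "h c \<in> \<real>" by (simp add: h_def w_def)
    qed
    ultimately obtain y where y: "\<And>c. c \<in> ball 0 1 \<Longrightarrow> h c = y"
      using real_valued_holomorphic_constant[of h "ball 0 1"] by (auto simp: constant_on_def)
    have "h c = h 0" using y[of c] y[of 0] cv by simp
    also have "h 0 = 1" by (simp add: h_def z)
    finally show ?thesis using r(3)[OF u] by (simp add: h_def cv(1))
  qed
  then show ?thesis using slice_holomorphic_identity[OF f g \<Omega> r(1,2) _ w] by blast
qed


section \<open>Integrals with exponents tending to 1\<close>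

text \<open>After division by \<open>a + b\<close> this is \<open>t \<le> t powr p\<close> on the
  unit interval, applied to two fractions with sum 1.\<close>

lemma powr_add_le:
  fixes a b p :: real
  assumes "0 \<le> a" "0 \<le> b" "0 < p" "p \<le> 1"
  shows "(a + b) powr p \<le> a powr p + b powr p"
proof (cases "a + b = 0")
  case True
  then have "a = 0" "b = 0" using assms by auto
  then show ?thesis by simp
next
  case False
  then have s: "a + b > 0" using assms by simp
  have le: "t \<le> t powr p" if "0 \<le> t" "t \<le> 1" for t :: real
  proof (cases "t = 0")
    case False
    then have "t powr 1 \<le> t powr p" using that assms by (intro powr_mono') auto
    then show ?thesis using that by simp
  qed simp
  have "1 = a / (a + b) + b / (a + b)" using s by (simp add: add_divide_distrib[symmetric])
  also have "\<dots> \<le> (a / (a + b)) powr p + (b / (a + b)) powr p"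
    using s assms by (intro add_mono le) auto
  also have "\<dots> = (a powr p + b powr p) / (a + b) powr p"
    using s assms by (simp add: powr_divide add_divide_distrib)
  finally show ?thesis using s by (simp add: field_simps)
qed

lemma norm_add_powr_le:
  assumes "0 < p" "p \<le> 1"
  shows "norm (x + y) powr p \<le> norm x powr p + norm y powr p"
proof -
  have "norm (x + y) powr p \<le> (norm x + norm y) powr p"
    using assms by (intro powr_mono2 norm_triangle_ineq) auto
  also have "\<dots> \<le> norm x powr p + norm y powr p" using assms by (intro powr_add_le) auto
  finally show ?thesis .
qed

lemma norm_diff_powr_le:
  assumes "0 < p" "p \<le> 1"
  shows "norm (x - y) powr p \<le> norm x powr p + norm y powr p"
  using norm_add_powr_le[OF assms, of x "- y"] by simp

lemma powr_le_one_plus_powr: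
  fixes x :: real
  assumes "0 \<le> x" "0 \<le> q" "q \<le> p"
  shows "x powr q \<le> 1 + x powr p"
proof (cases "x \<le> 1")
  case True
  then have "x powr q \<le> 1" using assms by (intro powr_le1) auto
  also have "\<dots> \<le> 1 + x powr p" by simp
  finally show ?thesis .
next
  case False
  then have "x powr q \<le> x powr p" using assms by (intro powr_mono) auto
  then show ?thesis by simp
qed

text \<open>Uniform integrability: the cut-off is \<open>L = e powr (1/(q - s))\<close>, so that \<open>x\<^sup>q\<^sup>-\<^sup>s \<le> e\<close> for \<open>x \<ge> L\<close>.\<close>
lemma powr_le_eps_powr:
  fixes q s e :: real
  assumes "0 < q" "q < s" "0 < e" "e \<le> 1"
  obtains K where "0 \<le> K" "\<And>x p. 0 \<le> x \<Longrightarrow> s \<le> p \<Longrightarrow> x powr q \<le> e * x powr p + K"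
proof -
  define L where "L = e powr (1 / (q - s))"
  have L: "L \<ge> 1"
  proof -
    have "e powr 0 \<le> e powr (1 / (q - s))" using assms by (intro powr_mono') auto
    then show ?thesis using assms by (simp add: L_def)
  qed
  show thesis
  proof (rule that[of "L powr q"])
    fix x p :: real assume x: "0 \<le> x" "s \<le> p"
    show "x powr q \<le> e * x powr p + L powr q"
    proof (cases "x \<le> L")
      case True
      then have "x powr q \<le> L powr q" using assms x by (intro powr_mono2) auto
      then show ?thesis using assms by (simp add: add_increasing)
    next
      case False
      then have x1: "x \<ge> 1" using L by simp
      have "x powr (q - p) \<le> x powr (q - s)" using x x1 by (intro powr_mono) auto
      also have "\<dots> \<le> L powr (q - s)" using False L assms by (intro powr_mono2') auto
      also have "\<dots> = e" using assms by (simp add: L_def powr_powr)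
      finally have "x powr (q - p) * x powr p \<le> e * x powr p" by (intro mult_right_mono) auto
      then have "x powr q \<le> e * x powr p" unfolding powr_add[symmetric] by simp
      then show ?thesis by (simp add: add_increasing2)
    qed
  qed simp
qed

section \<open>Fatou arguments for exponents tending to 1\<close>

lemma tendsto_norm_powr_one:
  fixes X :: "nat \<Rightarrow> 'a::real_normed_vector"
  assumes "X \<longlonglongrightarrow> x" "p \<longlonglongrightarrow> 1"
  shows "(\<lambda>n. norm (X n) powr p n) \<longlonglongrightarrow> norm x"
proof -
  have "(\<lambda>n. norm (X n) powr p n) \<longlonglongrightarrow> norm x powr 1"
    using assms by (intro tendsto_powr' tendsto_norm) auto
  then show ?thesis by simp
qed

text \<open>Fatou's lemma for Bochner integrals, in a form that also yields integrability of the
  limit.\<close>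

lemma fatou_bound:
  fixes h :: "nat \<Rightarrow> 'a \<Rightarrow> real"
  assumes int: "\<And>n. integrable M (h n)" and nn: "\<And>n x. x \<in> space M \<Longrightarrow> 0 \<le> h n x"
    and lim: "\<And>x. x \<in> space M \<Longrightarrow> (\<lambda>n. h n x) \<longlonglongrightarrow> l x"
    and meas: "l \<in> borel_measurable M"
    and bound: "\<forall>\<^sub>F n in sequentially. integral\<^sup>L M (h n) \<le> C"
  shows "integrable M l" "integral\<^sup>L M l \<le> C"
proof -
  have l0: "0 \<le> l x" if "x \<in> space M" for x
    by (rule LIMSEQ_le_const[OF lim]) (use nn that in auto)
  have I0: "0 \<le> integral\<^sup>L M (h n)" for n
    by (intro integral_nonneg_AE AE_I2 nn)
  obtain n0 where "integral\<^sup>L M (h n0) \<le> C" using bound by (auto simp: eventually_sequentially)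
  then have C: "0 \<le> C" using I0[of n0] by linarith
  have "(\<integral>\<^sup>+x. ennreal (l x) \<partial>M) = (\<integral>\<^sup>+x. liminf (\<lambda>n. ennreal (h n x)) \<partial>M)"
    by (intro nn_integral_cong lim_imp_Liminf[symmetric] tendsto_ennrealI lim) auto
  also have "\<dots> \<le> liminf (\<lambda>n. \<integral>\<^sup>+x. ennreal (h n x) \<partial>M)"
    by (intro nn_integral_liminf measurable_compose[OF borel_measurable_integrable[OF int] measurable_ennreal])
  also have "\<dots> = liminf (\<lambda>n. ennreal (integral\<^sup>L M (h n)))"
    using int nn by (intro arg_cong[where f=liminf] ext nn_integral_eq_integral) auto
  also have "\<dots> \<le> ennreal C"
    by (rule Liminf_le) (use bound in \<open>auto elim!: eventually_mono intro: ennreal_leI\<close>)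
  finally have le: "(\<integral>\<^sup>+x. ennreal (l x) \<partial>M) \<le> ennreal C" .
  show "integrable M l"
    using meas l0 le_less_trans[OF le] by (intro integrableI_nonneg) auto
  then have "ennreal (integral\<^sup>L M l) \<le> ennreal C"
    using le l0 by (simp add: nn_integral_eq_integral)
  then show "integral\<^sup>L M l \<le> C" using C by simp
qed

text \<open>The measure theory of two sequences of minimizers: \<open>m n\<close> is their common
  minimum, \<open>C\<close> a bound for all minima. Minimality itself enters through the hypotheses
  of the individual lemmas.\<close>

locale limit_pair = finite_measure M for M :: "'a measure" +
  fixes p :: "nat \<Rightarrow> real" and F G :: "nat \<Rightarrow> 'a \<Rightarrow> complex" and f g :: "'a \<Rightarrow> complex"
    and m :: "nat \<Rightarrow> real" and C :: real
  assumes exponents: "\<And>n. 0 < p n" "\<And>n. p n < 1" "p \<longlonglongrightarrow> 1"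
    and measF [measurable]: "\<And>n. F n \<in> borel_measurable M"
    and measG [measurable]: "\<And>n. G n \<in> borel_measurable M"
    and measf [measurable]: "f \<in> borel_measurable M" and measg [measurable]: "g \<in> borel_measurable M"
    and intF: "\<And>n. integrable M (\<lambda>x. cmod (F n x) powr p n)"
    and intG: "\<And>n. integrable M (\<lambda>x. cmod (G n x) powr p n)"
    and massF: "\<And>n. (LINT x|M. cmod (F n x) powr p n) = m n"
    and massG: "\<And>n. (LINT x|M. cmod (G n x) powr p n) = m n"
    and m_le: "\<And>n. m n \<le> C"
    and limF: "\<And>x. x \<in> space M \<Longrightarrow> (\<lambda>n. F n x) \<longlonglongrightarrow> f x"
    and limG: "\<And>x. x \<in> space M \<Longrightarrow> (\<lambda>n. G n x) \<longlonglongrightarrow> g x"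
begin

lemma integrable_limits:
  shows "integrable M (\<lambda>x. cmod (f x))" "integrable M (\<lambda>x. cmod (g x))"
    "(LINT x|M. cmod (f x)) \<le> C"
proof -
  have lim: "(\<lambda>n. cmod (F n x) powr p n) \<longlonglongrightarrow> cmod (f x)"
    "(\<lambda>n. cmod (G n x) powr p n) \<longlonglongrightarrow> cmod (g x)" if "x \<in> space M" for x
    by (intro tendsto_norm_powr_one limF limG exponents(3) that)+
  have bound: "\<forall>\<^sub>F n in sequentially. (LINT x|M. cmod (F n x) powr p n) \<le> C"
    "\<forall>\<^sub>F n in sequentially. (LINT x|M. cmod (G n x) powr p n) \<le> C"
    by (simp_all add: massF massG m_le)
  show "integrable M (\<lambda>x. cmod (f x))"
    by (rule fatou_bound(1)[OF intF _ lim(1) _ bound(1)]) auto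
  show "(LINT x|M. cmod (f x)) \<le> C"
    by (rule fatou_bound(2)[OF intF _ lim(1) _ bound(1)]) auto
  show "integrable M (\<lambda>x. cmod (g x))"
    by (rule fatou_bound(1)[OF intG _ lim(2) _ bound(2)]) auto
qed

text \<open>The midpoint defect \<open>h n\<close> is nonnegative by subadditivity, and
  \<open>mid\<close> bounds its integral by \<open>(2 * a n - 1) * C\<close>, which tends to 0. By
  Fatou the limiting defect in the triangle inequality has integral 0.\<close>

lemma AE_norm_add_eq:
  assumes mid: "\<And>n. m n \<le> (LINT x|M. cmod ((F n x + G n x) / 2) powr p n)"
  shows "AE x in M. cmod (f x + g x) = cmod (f x) + cmod (g x)"
proof -
  define a where "a n = 2 powr - p n" for n
  have a: "cmod ((F n x + G n x) / 2) powr p n = a n * cmod (F n x + G n x) powr p n" for n x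
    by (simp add: norm_divide powr_divide a_def powr_minus divide_simps)
  have a_lim: "a \<longlonglongrightarrow> 1/2"
  proof -
    have "a \<longlonglongrightarrow> 2 powr - 1" unfolding a_def using exponents by (intro tendsto_intros) auto
    then show ?thesis by (simp add: powr_minus_divide)
  qed
  define h where "h n x = a n * (cmod (F n x) powr p n + cmod (G n x) powr p n)
      - a n * cmod (F n x + G n x) powr p n" for n x
  define l where "l x = 1/2 * (cmod (f x) + cmod (g x)) - 1/2 * cmod (f x + g x)" for x
  have int_add: "integrable M (\<lambda>x. cmod (F n x + G n x) powr p n)" for n
    by (rule Bochner_Integration.integrable_bound[OF Bochner_Integration.integrable_add[OF intF[of n] intG[of n]]])
       (simp_all add: norm_add_powr_le exponents(1,2) less_imp_le)
  have int_h: "integrable M (h n)" for n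
    unfolding h_def using intF intG int_add by auto
  have nn: "0 \<le> h n x" for n x
    unfolding h_def using norm_add_powr_le[of "p n" "F n x" "G n x"] exponents(1,2)[of n]
    by (auto simp: a_def simp flip: right_diff_distrib)
  have lim: "(\<lambda>n. h n x) \<longlonglongrightarrow> l x" if "x \<in> space M" for x
    unfolding h_def l_def using limF[OF that] limG[OF that] exponents(3)
    by (intro tendsto_intros a_lim tendsto_norm_powr_one)
  have int_val: "integral\<^sup>L M (h n) \<le> (2 * a n - 1) * C" for n
  proof -
    have "integral\<^sup>L M (h n) = a n * (m n + m n) - (LINT x|M. cmod ((F n x + G n x) / 2) powr p n)"
      unfolding h_def a using intF intG int_add massF massG by simp
    also have "\<dots> \<le> (2 * a n - 1) * m n" using mid[of n] by (simp add: algebra_simps)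
    also have "\<dots> \<le> (2 * a n - 1) * C"
    proof (rule mult_left_mono[OF m_le])
      \<comment> \<open>Here \<open>p n < 1\<close> supplies the sign that allows \<open>m n\<close>
        to be replaced by \<open>C\<close>.\<close>
      have "2 powr - 1 \<le> a n" unfolding a_def using exponents(2)[of n] by (intro powr_mono) auto
      then show "0 \<le> 2 * a n - 1" by (simp add: powr_minus_divide)
    qed
    finally show ?thesis .
  qed
  have "(\<lambda>n. (2 * a n - 1) * C) \<longlonglongrightarrow> (2 * (1/2) - 1) * C"
    by (intro tendsto_intros a_lim)
  then have small: "\<forall>\<^sub>F n in sequentially. (2 * a n - 1) * C < e" if "0 < e" for e
    by (rule order_tendstoD(2)) (use that in simp)
  have meas_l: "l \<in> borel_measurable M" unfolding l_def by measurable
  have int_l: "integrable M l" "integral\<^sup>L M l \<le> e" if "0 < e" for e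
  proof -
    have "\<forall>\<^sub>F n in sequentially. integral\<^sup>L M (h n) \<le> e"
      using small[OF that] by eventually_elim (rule order_trans[OF int_val less_imp_le])
    from fatou_bound[OF int_h nn lim meas_l this] show "integrable M l" "integral\<^sup>L M l \<le> e"
      by simp_all
  qed
  have l0: "0 \<le> l x" for x
    unfolding l_def using norm_triangle_ineq[of "f x" "g x"] by simp
  have "integral\<^sup>L M l \<le> 0" by (rule field_le_epsilon) (use int_l in auto)
  then have "integral\<^sup>L M l = 0" using l0 by (intro antisym integral_nonneg_AE) auto
  then have "AE x in M. l x = 0"
    using integral_nonneg_eq_0_iff_AE[OF int_l(1)[of 1]] l0 by auto
  then show ?thesis by eventually_elim (simp add: l_def)
qed

lemma integrable_powr_limit:
  assumes "0 < q" "q \<le> 1"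
  shows "integrable M (\<lambda>x. cmod (f x) powr q)"
proof (rule Bochner_Integration.integrable_bound)
  show "integrable M (\<lambda>x. 1 + cmod (f x))" using integrable_limits by simp
  show "AE x in M. norm (cmod (f x) powr q) \<le> norm (1 + cmod (f x))"
    using powr_le_one_plus_powr[of _ q 1] assms by auto
qed measurable

text \<open>Fatou for \<open>|F j|^q\<close> would only bound the limit integral from above. Since
  \<open>q < 1\<close>, these powers are uniformly integrable: Fatou for
  \<open>e * |F j|^(p j) + K - |F j|^q \<ge> 0\<close> gives the lower bound up to an error
  proportional to \<open>e\<close>.\<close>

lemma lower_bound_limit:
  assumes q: "0 < q" "q < 1"
    and c: "\<forall>\<^sub>F j in sequentially. c \<le> (LINT x|M. cmod (F j x) powr q)"
  shows "c \<le> (LINT x|M. cmod (f x) powr q)"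
proof -
  \<comment> \<open>Strictly between \<open>q\<close> and 1: eventually all \<open>p j\<close>
    exceed \<open>s\<close>, so a single \<open>K\<close> serves the whole tail.\<close>
  define s where "s = (1 + q) / 2"
  have s: "q < s" "s < 1" using q by (auto simp: s_def)
  obtain N where N: "\<And>j. j \<ge> N \<Longrightarrow> s < p j" "\<And>j. j \<ge> N \<Longrightarrow> c \<le> (LINT x|M. cmod (F j x) powr q)"
    using eventually_conj[OF order_tendstoD(1)[OF exponents(3) s(2)] c] by (auto simp: eventually_sequentially)
  have "c \<le> (LINT x|M. cmod (f x) powr q) + e * (C - (LINT x|M. cmod (f x)))" if e: "0 < e" "e \<le> 1" for e
  proof -
    obtain K where K: "0 \<le> K" "\<And>x t. 0 \<le> x \<Longrightarrow> s \<le> t \<Longrightarrow> x powr q \<le> e * x powr t + K"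
      using powr_le_eps_powr[OF q(1) s(1) e] by metis
    define h where "h n x = e * cmod (F (n + N) x) powr p (n + N) + K - cmod (F (n + N) x) powr q" for n x
    define l where "l x = e * cmod (f x) + K - cmod (f x) powr q" for x
    have int_q: "integrable M (\<lambda>x. cmod (F (n + N) x) powr q)" for n
    proof (rule Bochner_Integration.integrable_bound)
      show "integrable M (\<lambda>x. 1 + cmod (F (n + N) x) powr p (n + N))" using intF by simp
      show "AE x in M. norm (cmod (F (n + N) x) powr q) \<le> norm (1 + cmod (F (n + N) x) powr p (n + N))"
        using powr_le_one_plus_powr[of _ q "p (n + N)"] q s N(1)[of "n + N"] by auto
    qed measurable
    have int_h: "integrable M (h n)" for n unfolding h_def using intF int_q by auto
    have nn: "0 \<le> h n x" for n x
      unfolding h_def using K(2)[of "cmod (F (n + N) x)" "p (n + N)"] N(1)[of "n + N"] by simp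
    have lim: "(\<lambda>n. h n x) \<longlonglongrightarrow> l x" if "x \<in> space M" for x
    proof -
      have 1: "(\<lambda>n. F (n + N) x) \<longlonglongrightarrow> f x" "(\<lambda>n. p (n + N)) \<longlonglongrightarrow> 1"
        using limF[OF that] exponents(3) by (auto intro: LIMSEQ_ignore_initial_segment)
      have "(\<lambda>n. cmod (F (n + N) x) powr q) \<longlonglongrightarrow> cmod (f x) powr q"
        using q by (intro tendsto_powr'[OF tendsto_norm[OF 1(1)] tendsto_const]) auto
      then show ?thesis
        unfolding h_def l_def
        by (intro tendsto_diff tendsto_add tendsto_mult tendsto_const tendsto_norm_powr_one 1)
    qed
    have bnd: "integral\<^sup>L M (h n) \<le> e * C + K * measure M (space M) - c" for n
    proof -
      have "integral\<^sup>L M (h n) = e * m (n + N) + K * measure M (space M)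
          - (LINT x|M. cmod (F (n + N) x) powr q)"
        unfolding h_def using intF int_q massF by (simp add: mult.commute)
      moreover have "e * m (n + N) \<le> e * C" using e m_le by simp
      ultimately show ?thesis using N(2)[of "n + N"] by simp
    qed
    have "integral\<^sup>L M l \<le> e * C + K * measure M (space M) - c"
      by (rule fatou_bound(2)[OF int_h nn lim]) (use bnd in \<open>auto simp: l_def\<close>)
    moreover have "integral\<^sup>L M l = e * (LINT x|M. cmod (f x)) + K * measure M (space M)
        - (LINT x|M. cmod (f x) powr q)"
      unfolding l_def using integrable_limits integrable_powr_limit[of q] q by (simp add: mult.commute)
    ultimately show ?thesis by (simp add: algebra_simps)
  qed
  note * = this
  define D where "D = C - (LINT x|M. cmod (f x))"
  have D: "0 \<le> D" using integrable_limits by (simp add: D_def)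
  show ?thesis
  proof (rule field_le_epsilon)
    fix \<epsilon> :: real assume \<epsilon>: "0 < \<epsilon>"
    \<comment> \<open>Chosen so that \<open>e * D \<le> \<epsilon>\<close>; \<open>D + 1\<close>
      avoids division by zero.\<close>
    define e where "e = min 1 (\<epsilon> / (D + 1))"
    have e: "0 < e" "e \<le> 1" using \<epsilon> D by (auto simp: e_def)
    have "e * D \<le> e * (D + 1)" using e by simp
    also have "\<dots> \<le> \<epsilon> / (D + 1) * (D + 1)" using D by (intro mult_right_mono) (auto simp: e_def)
    also have "\<dots> = \<epsilon>" using D by simp
    finally show "c \<le> (LINT x|M. cmod (f x) powr q) + \<epsilon>"
      using *[OF e] unfolding D_def[symmetric] by simp
  qed
qed

text \<open>Letting \<open>j\<close> and then \<open>k\<close> tend to infinity in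
  \<open>min\<close> shows that the minima eventually stay below \<open>I + e/4\<close>. Fatou for
  the defect in \<open>|F - G|^p \<le> |F|^p + |G|^p\<close>, whose limit is \<open>2 * |f|\<close>,
  then contradicts the lower bound \<open>e\<close>.\<close>

lemma dist_not_bounded_below:
  assumes fg: "\<And>x. x \<in> space M \<Longrightarrow> f x = g x"
    and min: "\<And>k. \<forall>\<^sub>F j in sequentially. m k \<le> (LINT x|M. cmod (F j x) powr p k)"
    and e: "0 < e" "\<And>n. e \<le> (LINT x|M. cmod (F n x - G n x) powr p n)"
  shows False
proof -
  define I where "I = (LINT x|M. cmod (f x))"
  have "(\<lambda>k. LINT x|M. cmod (f x) powr p k) \<longlonglongrightarrow> I"
    unfolding I_def
  proof (rule integral_dominated_convergence[where w = "\<lambda>x. 1 + cmod (f x)"])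
    show "AE x in M. (\<lambda>k. cmod (f x) powr p k) \<longlonglongrightarrow> cmod (f x)"
      by (intro AE_I2 tendsto_norm_powr_one tendsto_const exponents(3))
    show "AE x in M. norm (cmod (f x) powr p k) \<le> 1 + cmod (f x)" for k
      using powr_le_one_plus_powr[of _ "p k" 1] exponents(1,2)[of k] by auto
  qed (use integrable_limits in auto)
  then have "\<forall>\<^sub>F k in sequentially. (LINT x|M. cmod (f x) powr p k) < I + e/4"
    using e by (intro order_tendstoD) auto
  then have m_lt: "\<forall>\<^sub>F k in sequentially. m k < I + e/4"
  proof eventually_elim
    case (elim k)
    then show ?case using lower_bound_limit[OF exponents(1,2)[of k] min[of k]] by linarith
  qed
  define h where "h n x = cmod (F n x) powr p n + cmod (G n x) powr p n - cmod (F n x - G n x) powr p n" for n x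
  have int_diff: "integrable M (\<lambda>x. cmod (F n x - G n x) powr p n)" for n
    by (rule Bochner_Integration.integrable_bound[OF Bochner_Integration.integrable_add[OF intF[of n] intG[of n]]])
       (simp_all add: norm_diff_powr_le exponents(1,2) less_imp_le)
  have int_h: "integrable M (h n)" for n unfolding h_def using intF intG int_diff by auto
  have nn: "0 \<le> h n x" for n x
    unfolding h_def using norm_diff_powr_le[of "p n" "F n x" "G n x"] exponents(1,2)[of n] by simp
  have lim: "(\<lambda>n. h n x) \<longlonglongrightarrow> cmod (f x) + cmod (g x) - cmod (f x - g x)" if "x \<in> space M" for x
    unfolding h_def using limF[OF that] limG[OF that] exponents(3)
    by (intro tendsto_intros tendsto_norm_powr_one)
  \<comment> \<open>Two masses below \<open>I + e/4\<close> minus a distance of at least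
    \<open>e\<close> leave \<open>2 * I - e/2\<close>, less than the integral \<open>2 * I\<close>
    of the limit.\<close>
  have bound: "\<forall>\<^sub>F n in sequentially. integral\<^sup>L M (h n) \<le> 2 * I - e/2"
    using m_lt
  proof eventually_elim
    case (elim n)
    have "integral\<^sup>L M (h n) = m n + m n - (LINT x|M. cmod (F n x - G n x) powr p n)"
      unfolding h_def using intF intG int_diff massF massG by simp
    then show ?case using elim e(2)[of n] by linarith
  qed
  have "(LINT x|M. cmod (f x) + cmod (g x) - cmod (f x - g x)) \<le> 2 * I - e/2"
    by (rule fatou_bound(2)[OF int_h nn lim _ bound]) auto
  also have "(LINT x|M. cmod (f x) + cmod (g x) - cmod (f x - g x)) = (LINT x|M. 2 * cmod (f x))"
    using fg by (intro Bochner_Integration.integral_cong) auto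
  also have "\<dots> = 2 * I" by (simp add: I_def)
  finally show False using e by simp
qed

end


section \<open>Maximizers of the Bergman kernel\<close>

text \<open>Moves from set integrals to \<open>lebesgue_on\<close>, which is the finite measure that
  \<open>limit_pair\<close> is applied to.\<close>

lemma lebesgue_on_set_integral:
  fixes f :: "'a::euclidean_space \<Rightarrow> real"
  assumes "open \<Omega>"
  shows "(LINT w:\<Omega>|lebesgue. f w) = (LINT w|lebesgue_on \<Omega>. f w)"
    and "set_integrable lebesgue \<Omega> f \<longleftrightarrow> integrable (lebesgue_on \<Omega>) f"
  using assms
  by (auto simp: set_lebesgue_integral_def set_integrable_def integral_restrict_space integrable_restrict_space)

text \<open>The set where \<open>\<phi>\<close> is nonzero is open and null, hence empty.\<close>

lemma continuous_AE_eq_zero: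
  fixes \<phi> :: "'a::euclidean_space \<Rightarrow> 'b::real_normed_vector"
  assumes \<Omega>: "open \<Omega>" and cont: "continuous_on \<Omega> \<phi>"
    and AE: "AE x in lebesgue_on \<Omega>. \<phi> x = 0" and x: "x \<in> \<Omega>"
  shows "\<phi> x = 0"
proof (rule ccontr)
  define U where "U = \<Omega> \<inter> \<phi> -` (- {0})"
  assume "\<phi> x \<noteq> 0"
  then have "U \<noteq> {}" using x by (auto simp: U_def)
  moreover have "open U"
    unfolding U_def by (rule continuous_open_preimage[OF cont \<Omega>]) auto
  moreover have "negligible U"
  proof -
    have "AE x in lebesgue. x \<in> \<Omega> \<longrightarrow> \<phi> x = 0"
      using AE \<Omega> by (subst (asm) AE_restrict_space_iff) auto
    then have "AE x in lebesgue. x \<notin> U" by eventually_elim (auto simp: U_def)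
    then show ?thesis
      using \<open>open U\<close> by (simp add: negligible_iff_null_sets AE_iff_null_sets)
  qed
  ultimately show False using open_not_negligible by blast
qed

lemma holomorphic_vec_on_const: "holomorphic_vec_on (\<lambda>w. c) \<Omega>"
  unfolding holomorphic_vec_on_def by (auto intro!: exI[of _ "\<lambda>_. 0"] derivative_eq_intros)

lemma holomorphic_vec_on_midpoint:
  assumes "holomorphic_vec_on f \<Omega>" "holomorphic_vec_on g \<Omega>"
  shows "holomorphic_vec_on (\<lambda>w. (f w + g w) / 2) \<Omega>"
  unfolding holomorphic_vec_on_def
proof
  fix z assume "z \<in> \<Omega>"
  then obtain D E where "(f has_derivative D) (at z)" "\<forall>c v. D (c *s v) = c * D v"
    "(g has_derivative E) (at z)" "\<forall>c v. E (c *s v) = c * E v"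
    using assms unfolding holomorphic_vec_on_def by metis
  then show "\<exists>D. ((\<lambda>w. (f w + g w) / 2) has_derivative D) (at z) \<and> (\<forall>c v. D (c *s v) = c * D v)"
    by (intro exI[of _ "\<lambda>v. (D v + E v) / 2"])
       (auto intro!: has_derivative_add has_derivative_divide' has_derivative_divide[of _ _ _ _ "\<lambda>_. 2" "\<lambda>_. 0", simplified]
             simp: algebra_simps add_divide_distrib)
qed

section \<open>Minimizers of the p-integral on a bounded open set\<close>

context
  fixes \<Omega> :: "(complex ^ 'n) set"
  assumes \<Omega>: "open \<Omega>" "bounded \<Omega>"
begin

lemma holomorphic_vec_on_measurable:
  assumes "holomorphic_vec_on f \<Omega>" shows "f \<in> borel_measurable (lebesgue_on \<Omega>)"
  using holomorphic_vec_on_continuous_on[OF assms] \<Omega>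
  by (intro continuous_imp_measurable_on_sets_lebesgue) auto

lemma finite_measure_lebesgue_on_domain: "finite_measure (lebesgue_on \<Omega>)"
  using \<Omega> lmeasurable_open by (intro finite_measure_lebesgue_on) blast

lemma bergman_space_iff:
  "f \<in> bergman_space \<Omega> p \<longleftrightarrow>
     holomorphic_vec_on f \<Omega> \<and> integrable (lebesgue_on \<Omega>) (\<lambda>w. cmod (f w) powr p)"
  using \<Omega> by (simp add: bergman_space_def lebesgue_on_set_integral)

lemma bergman_space_const: "(\<lambda>w. c) \<in> bergman_space \<Omega> p"
proof -
  interpret finite_measure "lebesgue_on \<Omega>" by (rule finite_measure_lebesgue_on_domain)
  show ?thesis by (simp add: bergman_space_iff holomorphic_vec_on_const)
qed

text \<open>On a set of finite measure \<open>|f|^q \<le> 1 + |f|^p\<close> is integrable.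
  Minimizers thereby become competitors for smaller exponents.\<close>

lemma bergman_space_antimono:
  assumes "f \<in> bergman_space \<Omega> p" "0 < q" "q \<le> p"
  shows "f \<in> bergman_space \<Omega> q"
proof -
  interpret finite_measure "lebesgue_on \<Omega>" by (rule finite_measure_lebesgue_on_domain)
  have hol: "holomorphic_vec_on f \<Omega>" and int: "integrable (lebesgue_on \<Omega>) (\<lambda>w. cmod (f w) powr p)"
    using assms by (auto simp: bergman_space_iff)
  note [measurable] = holomorphic_vec_on_measurable[OF hol]
  have "integrable (lebesgue_on \<Omega>) (\<lambda>w. cmod (f w) powr q)"
  proof (rule Bochner_Integration.integrable_bound)
    show "integrable (lebesgue_on \<Omega>) (\<lambda>w. 1 + cmod (f w) powr p)" using int by simp
    show "AE w in lebesgue_on \<Omega>. norm (cmod (f w) powr q) \<le> norm (1 + cmod (f w) powr p)"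
      using powr_le_one_plus_powr[of _ q p] assms by auto
  qed measurable
  then show ?thesis using hol by (simp add: bergman_space_iff)
qed

lemma bergman_space_midpoint:
  assumes f: "f \<in> bergman_space \<Omega> p" and g: "g \<in> bergman_space \<Omega> p" and p: "0 < p" "p \<le> 1"
  shows "(\<lambda>w. (f w + g w) / 2) \<in> bergman_space \<Omega> p"
proof -
  have hol: "holomorphic_vec_on (\<lambda>w. (f w + g w) / 2) \<Omega>"
    using f g by (auto simp: bergman_space_iff intro: holomorphic_vec_on_midpoint)
  note [measurable] = holomorphic_vec_on_measurable[OF hol]
  have "integrable (lebesgue_on \<Omega>) (\<lambda>w. cmod ((f w + g w) / 2) powr p)"
  proof (rule Bochner_Integration.integrable_bound)
    show "integrable (lebesgue_on \<Omega>) (\<lambda>w. cmod (f w) powr p + cmod (g w) powr p)"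
      using f g by (simp add: bergman_space_iff)
    have "cmod ((f w + g w) / 2) powr p \<le> cmod (f w) powr p + cmod (g w) powr p" for w
    proof -
      have "cmod ((f w + g w) / 2) powr p \<le> cmod (f w + g w) powr p"
        using p by (intro powr_mono2) (auto simp: norm_divide)
      also have "\<dots> \<le> cmod (f w) powr p + cmod (g w) powr p" using p by (rule norm_add_powr_le)
      finally show ?thesis .
    qed
    then show "AE w in lebesgue_on \<Omega>. norm (cmod ((f w + g w) / 2) powr p)
        \<le> norm (cmod (f w) powr p + cmod (g w) powr p)" by simp
  qed measurable
  then show ?thesis using hol by (simp add: bergman_space_iff)
qed

lemma bergman_integral_pos:
  assumes f: "f \<in> bergman_space \<Omega> p" and z: "z \<in> \<Omega>" "f z \<noteq> 0"
  shows "0 < (LINT w|lebesgue_on \<Omega>. cmod (f w) powr p)"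
proof (rule ccontr)
  assume "\<not> 0 < (LINT w|lebesgue_on \<Omega>. cmod (f w) powr p)"
  moreover have "0 \<le> (LINT w|lebesgue_on \<Omega>. cmod (f w) powr p)" by (rule integral_nonneg_AE) simp
  ultimately have "(LINT w|lebesgue_on \<Omega>. cmod (f w) powr p) = 0" by simp
  then have "AE w in lebesgue_on \<Omega>. cmod (f w) powr p = 0"
    using f by (subst (asm) integral_nonneg_eq_0_iff_AE) (auto simp: bergman_space_iff)
  then have "AE w in lebesgue_on \<Omega>. f w = 0" by simp
  from continuous_AE_eq_zero[OF \<Omega>(1) _ this z(1)] z(2) f show False
    by (auto simp: bergman_space_iff holomorphic_vec_on_continuous_on)
qed

lemma bergman_quotient_eq:
  assumes "p \<noteq> 0" "cmod (f z) = 1"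
  shows "bergman_quotient \<Omega> p z f = 1 / (LINT w|lebesgue_on \<Omega>. cmod (f w) powr p)"
proof -
  have "0 \<le> (LINT w|lebesgue_on \<Omega>. cmod (f w) powr p)" by (rule integral_nonneg_AE) simp
  then show ?thesis
    using assms \<Omega> by (simp add: bergman_quotient_def bergman_norm_def powr_powr lebesgue_on_set_integral)
qed

text \<open>With value 1 at \<open>z\<close> the quotient is the reciprocal of the integral, so the
  largest quotient means the smallest integral.\<close>

lemma maximizer_minimizes:
  assumes f: "maximizer \<Omega> p z f" "f z = 1" and h: "h \<in> bergman_space \<Omega> p" "h z = 1"
    and z: "z \<in> \<Omega>" and p: "0 < p"
  shows "(LINT w|lebesgue_on \<Omega>. cmod (f w) powr p) \<le> (LINT w|lebesgue_on \<Omega>. cmod (h w) powr p)"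
proof -
  have "h \<in> bergman_nonzero \<Omega> p" using h z by (auto simp: bergman_nonzero_def intro!: bexI[of _ z])
  then have "ennreal (bergman_quotient \<Omega> p z h) \<le> ennreal (bergman_quotient \<Omega> p z f)"
    using f unfolding maximizer_def by (auto simp: bergman_kernel_def intro: SUP_upper)
  moreover have f': "f \<in> bergman_space \<Omega> p" using f by (auto simp: maximizer_def bergman_nonzero_def)
  moreover note bergman_integral_pos[OF f' z] bergman_integral_pos[OF h(1) z]
  ultimately show ?thesis
    using p f h by (simp add: bergman_quotient_eq field_simps)
qed

text \<open>Stated as a contradiction because a lower bound on all distances passes to the
  subsequences that compactness provides.\<close>

lemma maximizer_dist_not_bounded_below:
  fixes f g :: "nat \<Rightarrow> complex ^ 'n \<Rightarrow> complex"
  assumes conn: "connected \<Omega>" and z: "z \<in> \<Omega>"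
    and p: "\<And>n. 1/2 < p n" "\<And>n. p n < 1" "p \<longlonglongrightarrow> 1"
    and f: "\<And>n. maximizer \<Omega> (p n) z (f n)" "\<And>n. f n z = 1"
    and g: "\<And>n. maximizer \<Omega> (p n) z (g n)" "\<And>n. g n z = 1"
    and e: "0 < e" "\<And>n. e \<le> bergman_dist \<Omega> (p n) (f n) (g n)"
  shows False
proof -
  \<comment> \<open>The constant function 1 is a competitor, so the volume of
    \<open>\<Omega>\<close> bounds all minima.\<close>
  define C where "C = measure (lebesgue_on \<Omega>) (space (lebesgue_on \<Omega>))"
  have p0: "0 < p n" for n using p(1)[of n] by simp
  have sp: "f n \<in> bergman_space \<Omega> (p n)" "g n \<in> bergman_space \<Omega> (p n)" for n
    using f g by (auto simp: maximizer_def bergman_nonzero_def)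
  have hol: "holomorphic_vec_on (f n) \<Omega>" "holomorphic_vec_on (g n) \<Omega>" for n
    using sp by (auto simp: bergman_space_iff)
  have mass_le: "(LINT w|lebesgue_on \<Omega>. cmod (h w) powr p n) \<le> C"
    if "maximizer \<Omega> (p n) z h" "h z = 1" for n h
    using maximizer_minimizes[OF that bergman_space_const[of 1] _ z p0] by (simp add: C_def)
  have bounded: "\<exists>B. \<forall>n. \<forall>w\<in>K. cmod (h n w) \<le> B"
    if K: "compact K" "K \<subseteq> \<Omega>" and h: "\<And>n. maximizer \<Omega> (p n) z (h n)" "\<And>n. h n z = 1" for K h
  proof -
    obtain B where B: "\<And>f p w. \<lbrakk>f \<in> bergman_space \<Omega> p; 1/2 \<le> p; p \<le> 1;
       (LINT u:\<Omega>|lebesgue. cmod (f u) powr p) \<le> C; w \<in> K\<rbrakk> \<Longrightarrow> cmod (f w) \<le> B"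
      using bergman_bounded_on_compact[OF \<Omega>(1) K] by metis
    have "cmod (h n w) \<le> B" if "w \<in> K" for n w
    proof (rule B[of _ "p n"])
      show "h n \<in> bergman_space \<Omega> (p n)" using h by (auto simp: maximizer_def bergman_nonzero_def)
      show "(LINT u:\<Omega>|lebesgue. cmod (h n u) powr p n) \<le> C"
        using mass_le[OF h] \<Omega> by (simp add: lebesgue_on_set_integral)
    qed (use p(1,2)[of n] that in auto)
    then show ?thesis by blast
  qed
  interpret f: locally_bounded_sequence f \<Omega>
    using hol bounded f \<Omega> by unfold_locales auto
  obtain k1 where k1: "strict_mono (k1 :: nat \<Rightarrow> nat)" "\<And>w. w \<in> \<Omega> \<Longrightarrow> convergent (\<lambda>n. f (k1 n) w)"
    using f.pointwise_convergent_subsequence by blast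
  interpret g: locally_bounded_sequence "\<lambda>n. g (k1 n)" \<Omega>
  proof
    show "\<exists>B. \<forall>n. \<forall>w\<in>K. cmod (g (k1 n) w) \<le> B" if "compact K" "K \<subseteq> \<Omega>" for K
      using bounded[OF that g] by blast
  qed (use hol \<Omega> in auto)
  obtain k2 where k2: "strict_mono (k2 :: nat \<Rightarrow> nat)" "\<And>w. w \<in> \<Omega> \<Longrightarrow> convergent (\<lambda>n. g (k1 (k2 n)) w)"
    using g.pointwise_convergent_subsequence by blast
  \<comment> \<open>The second extraction runs along the first, so both \<open>f\<close> and
    \<open>g\<close> converge along \<open>k\<close>.\<close>
  define k where "k n = k1 (k2 n)" for n
  have k: "strict_mono k" using k1(1) k2(1) by (simp add: k_def strict_mono_def)
  define F where "F w = lim (\<lambda>n. f (k n) w)" for w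
  define G where "G w = lim (\<lambda>n. g (k n) w)" for w
  have limG: "(\<lambda>n. g (k n) w) \<longlonglongrightarrow> G w" if "w \<in> \<Omega>" for w
    using k2(2)[OF that] unfolding k_def G_def by (simp add: convergent_LIMSEQ_iff)
  have limF: "(\<lambda>n. f (k n) w) \<longlonglongrightarrow> F w" if "w \<in> \<Omega>" for w
  proof -
    have "convergent (\<lambda>n. f (k n) w)"
      using convergent_subseq_convergent[OF k1(2)[OF that] k2(1)] by (simp add: k_def o_def)
    then show ?thesis unfolding F_def by (simp add: convergent_LIMSEQ_iff)
  qed
  interpret fk: locally_bounded_sequence "\<lambda>n. f (k n)" \<Omega>
  proof
    show "\<exists>B. \<forall>n. \<forall>w\<in>K. cmod (f (k n) w) \<le> B" if "compact K" "K \<subseteq> \<Omega>" for K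
      using bounded[OF that f] by blast
  qed (use hol \<Omega> in auto)
  interpret gk: locally_bounded_sequence "\<lambda>n. g (k n)" \<Omega>
  proof
    show "\<exists>B. \<forall>n. \<forall>w\<in>K. cmod (g (k n) w) \<le> B" if "compact K" "K \<subseteq> \<Omega>" for K
      using bounded[OF that g] by blast
  qed (use hol \<Omega> in auto)
  note contF = fk.limit_continuous[OF limF] and contG = gk.limit_continuous[OF limG]
  define m where "m n = (LINT w|lebesgue_on \<Omega>. cmod (f (k n) w) powr p (k n))" for n
  interpret finite_measure "lebesgue_on \<Omega>" by (rule finite_measure_lebesgue_on_domain)
  have pk: "(\<lambda>n. p (k n)) \<longlonglongrightarrow> 1" using LIMSEQ_subseq_LIMSEQ[OF p(3) k] by (simp add: o_def)
  interpret limit_pair "lebesgue_on \<Omega>" "\<lambda>n. p (k n)" "\<lambda>n. f (k n)" "\<lambda>n. g (k n)" F G m C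
  proof
    \<comment> \<open>Each of the two functions is a competitor for the other, so their integrals
      agree.\<close>
    show "(LINT w|lebesgue_on \<Omega>. cmod (g (k n) w) powr p (k n)) = m n" for n
      unfolding m_def
      by (intro antisym maximizer_minimizes[OF f sp(2) g(2) z p0] maximizer_minimizes[OF g sp(1) f(2) z p0])
    show "m n \<le> C" for n unfolding m_def by (rule mass_le[OF f])
    show "F \<in> borel_measurable (lebesgue_on \<Omega>)" "G \<in> borel_measurable (lebesgue_on \<Omega>)"
      using contF contG \<Omega> by (auto intro: continuous_imp_measurable_on_sets_lebesgue)
    show "(\<lambda>n. f (k n) x) \<longlonglongrightarrow> F x" "(\<lambda>n. g (k n) x) \<longlonglongrightarrow> G x" if "x \<in> space (lebesgue_on \<Omega>)" for x
      using limF limG that by auto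
  qed (use p0 p(2) pk sp hol in \<open>auto simp: m_def bergman_space_iff holomorphic_vec_on_measurable\<close>)
  have "AE w in lebesgue_on \<Omega>. cmod (F w + G w) = cmod (F w) + cmod (G w)"
  proof (rule AE_norm_add_eq)
    fix n
    show "m n \<le> (LINT x|lebesgue_on \<Omega>. cmod ((f (k n) x + g (k n) x) / 2) powr p (k n))"
      unfolding m_def
      by (rule maximizer_minimizes[OF f bergman_space_midpoint[OF sp] _ z p0])
         (use f g p0 p(2) in \<open>auto intro: less_imp_le\<close>)
  qed
  \<comment> \<open>Continuity of \<open>F\<close> and \<open>G\<close> upgrades the almost
    everywhere identity to all of \<open>\<Omega>\<close>.\<close>
  then have "AE w in lebesgue_on \<Omega>. cmod (F w + G w) - (cmod (F w) + cmod (G w)) = 0" by simp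
  from continuous_AE_eq_zero[OF \<Omega>(1) _ this]
  have add: "cmod (F w + G w) = cmod (F w) + cmod (G w)" if "w \<in> \<Omega>" for w
    using that contF contG by (simp add: continuous_intros)
  have "F z = 1" "G z = 1" by (simp_all add: F_def G_def f g)
  then have FG: "F w = G w" if "w \<in> \<Omega>" for w
    using slice_holomorphic_eq_of_norm_add[OF fk.limit_slice_holomorphic[OF limF]
        gk.limit_slice_holomorphic[OF limG] contG \<Omega>(1) conn z _ _ add that] by simp
  show False
  proof (rule dist_not_bounded_below)
    show "F x = G x" if "x \<in> space (lebesgue_on \<Omega>)" for x using FG that by simp
    \<comment> \<open>As soon as \<open>p (k j) > p (k n)\<close>, the function
      \<open>f (k j)\<close> lies in the space for the exponent \<open>p (k n)\<close> and competes
      there.\<close>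
    show "\<forall>\<^sub>F j in sequentially. m n \<le> (LINT x|lebesgue_on \<Omega>. cmod (f (k j) x) powr p (k n))" for n
      using order_tendstoD(1)[OF pk p(2)[of "k n"]]
    proof eventually_elim
      case (elim j)
      show ?case
        unfolding m_def
        by (rule maximizer_minimizes[OF f bergman_space_antimono[OF sp(1)[of "k j"]] f(2) z p0])
           (use elim p0 in auto)
    qed
    show "0 < e" by (rule e)
    show "e \<le> (LINT x|lebesgue_on \<Omega>. cmod (f (k n) x - g (k n) x) powr p (k n))" for n
      using e(2)[of "k n"] \<Omega> by (simp add: bergman_dist_def lebesgue_on_set_integral)
  qed
qed

end

theorem theorem1p3:
  fixes \<Omega> :: "(complex ^ 'n) set" and z :: "complex ^ 'n"
  assumes "bounded_domain \<Omega>" and "z \<in> \<Omega>"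
  shows "((\<lambda>p. maximizer_diam \<Omega> p z) \<longlongrightarrow> 0) (at_left 1)"
proof (rule tendsto_at_left_sequentially[of "1/2"])
  have \<Omega>: "open \<Omega>" "bounded \<Omega>" "connected \<Omega>" using assms(1) by (auto simp: bounded_domain_def)
  fix S :: "nat \<Rightarrow> real"
  \<comment> \<open>The lower bound 1/2 keeps the exponents in the range of the uniform sup
    estimate.\<close>
  assume S: "\<And>n. S n < 1" "\<And>n. 1/2 < S n" "S \<longlonglongrightarrow> 1"
  show "(\<lambda>n. maximizer_diam \<Omega> (S n) z) \<longlonglongrightarrow> 0"
  proof (rule order_tendstoI)
    fix a :: ennreal assume "0 < a"
    \<comment> \<open>An intermediate \<open>b\<close> is finite, and since it lies strictly below
      the supremum some pair exceeds it, whether or not the supremum is attained.\<close>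
    then obtain b where b: "0 < b" "b < a" using dense by blast
    then obtain e where e: "b = ennreal e" "0 < e" by (cases b) (auto simp: ennreal_less_zero_iff)
    show "\<forall>\<^sub>F n in sequentially. maximizer_diam \<Omega> (S n) z < a"
    proof (rule ccontr)
      assume "\<not> (\<forall>\<^sub>F n in sequentially. maximizer_diam \<Omega> (S n) z < a)"
      then obtain r where r: "strict_mono (r :: nat \<Rightarrow> nat)" "\<And>n. a \<le> maximizer_diam \<Omega> (S (r n)) z"
        using not_eventually_sequentiallyD by (metis linorder_not_less)
      have "\<exists>f g. (maximizer \<Omega> (S (r n)) z f \<and> maximizer \<Omega> (S (r n)) z g \<and> f z = 1 \<and> g z = 1)
          \<and> e \<le> bergman_dist \<Omega> (S (r n)) f g" for n
      proof -
        have "ennreal e < maximizer_diam \<Omega> (S (r n)) z" using b e r(2)[of n] by simp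
        then obtain f g where fg: "maximizer \<Omega> (S (r n)) z f" "maximizer \<Omega> (S (r n)) z g" "f z = 1" "g z = 1"
          "ennreal e < ennreal (bergman_dist \<Omega> (S (r n)) f g)"
          unfolding maximizer_diam_def less_Sup_iff by blast
        then show ?thesis using e by (metis ennreal_less_iff less_imp_le)
      qed
      then obtain f g where fg: "\<And>n. maximizer \<Omega> (S (r n)) z (f n)" "\<And>n. maximizer \<Omega> (S (r n)) z (g n)"
        "\<And>n. f n z = 1" "\<And>n. g n z = 1" "\<And>n. e \<le> bergman_dist \<Omega> (S (r n)) (f n) (g n)"
        by metis
      have "(\<lambda>n. S (r n)) \<longlonglongrightarrow> 1" using LIMSEQ_subseq_LIMSEQ[OF S(3) r(1)] by (simp add: o_def)
      from maximizer_dist_not_bounded_below[OF \<Omega> assms(2) S(2,1) this fg(1,3,2,4) e(2) fg(5)] show False .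
    qed
  qed simp
qed simp

end
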